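(* There is an absolute constant $d$ with the following property. Let $\mathcal{C}=\mathcal{C}_1\cup\mathcal{C}_2$ be a family of $n$ $x$-monotone curves in which every two curves have at most one common point and no three share a common point, such that the left endpoints of all curves in $\mathcal{C}$ lie on a common vertical line, and for every $c_1\in\mathcal{C}_1$ and $c_2\in\mathcal{C}_2$ the left endpoint of $c_1$ is lower than the left endpoint of $c_2$. Then the number of tangent pairs $\{c_1,c_2\}$ with $c_1\in\mathcal{C}_1$, $c_2\in\mathcal{C}_2$ is at most $dn^{4/3}$.
   Context: A curve is $x$-monotone if it is the graph of a continuous function on a closed interval; its left endpoint is its point of smallest $x$-coordinate. Curves intersect in finitely many points. Two curves are tangent if they have precisely one common point and it is not a crossing point. *)

theory Defs
  imports Complex_Main
begin

definition x_monotone_curve :: "(real \<times> real) set \<Rightarrow> bool" where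
  "x_monotone_curve c \<longleftrightarrow>
     (\<exists>a b f. a < b \<and> continuous_on {a..b} f \<and> c = (\<lambda>x. (x, f x)) ` {a..b})"

definition left_endpoint :: "(real \<times> real) set \<Rightarrow> real \<times> real" where
  "left_endpoint c = arg_min_on fst c"

text \<open>In particular both curves have a point over every \<open>x\<close> in \<open>X\<close>.\<close>
definition below_over :: "real set \<Rightarrow> (real \<times> real) set \<Rightarrow> (real \<times> real) set \<Rightarrow> bool" where
  "below_over X c c' \<longleftrightarrow> (\<forall>x\<in>X. \<exists>y y'. (x, y) \<in> c \<and> (x, y') \<in> c' \<and> y < y')"

text \<open>The two sides of an x-monotone curve near one of its points are the parts above and below
  it, so two such curves cross at a common point if one passes there from below to above the
  other. Both must extend to both sides of the point: a common point that is an endpoint of one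
  of the curves is not a crossing point.\<close>
definition crossing_point ::
    "(real \<times> real) set \<Rightarrow> (real \<times> real) set \<Rightarrow> real \<times> real \<Rightarrow> bool" where
  "crossing_point c c' p \<longleftrightarrow> p \<in> c \<inter> c' \<and>
     (\<exists>e>0. below_over {fst p - e<..<fst p} c c' \<and> below_over {fst p<..<fst p + e} c' c \<or>
            below_over {fst p - e<..<fst p} c' c \<and> below_over {fst p<..<fst p + e} c c')"

definition tangent :: "(real \<times> real) set \<Rightarrow> (real \<times> real) set \<Rightarrow> bool" where
  "tangent c c' \<longleftrightarrow> (\<exists>p. c \<inter> c' = {p} \<and> \<not> crossing_point c c' p)"

end

theory Submission imports Defs "HOL-Library.FuncSet" begin

text \<open>A curve of the lower family stays weakly below every curve of the upper family that it
  touches. By symmetry it suffices to count the touching pairs \<open>a\<close>, \<open>b\<close> (with \<open>a\<close> lower) for which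
  \<open>a\<close> ends first. Join any two upper curves that are touched consecutively by some \<open>a\<close>. As in the
  duality between lines and points, the upper curves behave like points ordered by their initial
  heights, the time at which two of them cross is the slope of the segment between them, and the
  curves touched by a single \<open>a\<close> form a convex chain. Two such chains cross boundedly often because
  the lower curves cross at most once. A set of edges without crossings is linear in the number of
  points, by charging each angle between consecutive edges at a point to the leftmost point in that
  angle, so the sampling proof of the crossing lemma bounds the number of distinct edges by a
  multiple of \<open>n powr (4/3)\<close>.

  Since curves may end, the same edge can be used by several lower curves. These are then nested in
  time: the remaining life of the inner one takes place before the outer one reaches the second
  upper curve. Comparing the numbers of touches still to come shows that, up to \<open>n powr (4/3)\<close>
  exceptions, an edge is used boundedly often.\<close>

section \<open>Counting lemmas\<close>

text \<open>Two scales fix the exponents. With n curves, the sampling rate is of order n powr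
  (-1/3), and an edge is steep if along it the number of touches to come drops by the factor 1 +
  1/\<rho>, with \<rho> of order n powr (1/4). A curve then has O(\<rho> log n) steep edges, which
  is within n powr (1/3). For the nonsteep users of one edge these numbers differ by factors above
  \<rho> within a range up to n^2, so boundedly many fit. An integer M of order n powr (1/12) makes
  both scales powers of M and keeps the counting in the natural numbers. The endings are the real
  obstacle. If no curve ended, an edge would belong to one chain only, and the curves could simply
  be compared by height at any given time. As it is, a crossing of two edges is a statement about
  paths of comparisons made at various times; it has to be turned back into times at which actual
  curves meet before the condition of at most one common point can be applied.\<close>

lemma card_functions_zero_on:
  fixes K :: nat
  assumes "finite B" "Y \<subseteq> B" "K \<ge> 1"
  shows "card {f \<in> B \<rightarrow>\<^sub>E {..<K}. \<forall>y\<in>Y. f y = 0} * K ^ card Y = K ^ card B"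
proof -
  have "{f \<in> B \<rightarrow>\<^sub>E {..<K}. \<forall>y\<in>Y. f y = 0} = (\<Pi>\<^sub>E x\<in>B. if x \<in> Y then {0} else {..<K})"
  proof (intro equalityI subsetI)
    fix f assume "f \<in> (\<Pi>\<^sub>E x\<in>B. if x \<in> Y then {0} else {..<K})"
    then have f: "f \<in> extensional B" "\<And>x. x \<in> B \<Longrightarrow> f x \<in> (if x \<in> Y then {0} else {..<K})"
      by (auto simp: PiE_iff)
    have "f y = 0" if "y \<in> Y" for y using f(2)[of y] that assms(2) by auto
    moreover have "f x < K" if "x \<in> B" for x using f(2)[OF that] assms(3) by (cases "x \<in> Y") auto
    ultimately show "f \<in> {f \<in> B \<rightarrow>\<^sub>E {..<K}. \<forall>y\<in>Y. f y = 0}" using f(1) by (auto simp: PiE_iff)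
  qed (auto simp: PiE_iff)
  also have "card \<dots> = (\<Prod>x\<in>B. if x \<in> Y then 1 else K)"
    using assms by (subst card_PiE) (auto intro!: prod.cong)
  also have "\<dots> = (\<Prod>x\<in>B - Y. K)"
    using assms by (intro prod.mono_neutral_cong_right) auto
  also have "\<dots> = K ^ card (B - Y)" by simp
  finally show ?thesis
    using card_Diff_subset[OF finite_subset[OF assms(2,1)] assms(2)] card_mono[OF assms(1,2)]
    by (simp only: power_add[symmetric] le_add_diff_inverse2)
qed

text \<open>The sampling argument of the crossing lemma: the hypothesis is averaged over all random
  subsets of \<open>B\<close> in which every element occurs with probability \<open>1/K\<close>.\<close>
lemma sampling_bound:
  fixes K :: nat
  assumes B: "finite B" and S: "S \<subseteq> B \<times> B" "\<And>b c. (b, c) \<in> S \<Longrightarrow> b \<noteq> c"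
    and X: "X \<subseteq> S \<times> S" "\<And>b b' c c'. ((b, b'), (c, c')) \<in> X \<Longrightarrow> card {b, b', c, c'} = 4"
    and H: "\<And>V. V \<subseteq> B \<Longrightarrow> card {e \<in> S. e \<in> V \<times> V} \<le>
         3 * card V + card {x \<in> X. fst x \<in> V \<times> V \<and> snd x \<in> V \<times> V}"
    and K: "K \<ge> 1"
  shows "card S * K ^ 2 \<le> 3 * card B * K ^ 3 + card X"
proof -
  define \<Omega> where "\<Omega> = B \<rightarrow>\<^sub>E {..<K}"
  define V where "V = (\<lambda>f :: 'a \<Rightarrow> nat. {b \<in> B. f b = 0})"
  have fin: "finite \<Omega>" "finite S" "finite X"
    using B S(1) X(1) finite_subset[of S "B \<times> B"] finite_subset[of X "S \<times> S"]
    by (auto simp: \<Omega>_def finite_PiE)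
  have swap: "(\<Sum>f\<in>\<Omega>. card {x \<in> Z. P f x}) = (\<Sum>x\<in>Z. card {f \<in> \<Omega>. P f x})" if "finite Z" for Z and P :: "('a \<Rightarrow> nat) \<Rightarrow> 'z \<Rightarrow> bool"
    using sum.swap_restrict[OF fin(1) that, of "\<lambda>_ _. 1 :: nat" P] by simp
  have cnt: "card {f \<in> \<Omega>. \<forall>y\<in>Y. f y = 0} * K ^ card Y = K ^ card B" if "Y \<subseteq> B" for Y
    unfolding \<Omega>_def by (rule card_functions_zero_on[OF B that K])
  \<comment> \<open>\<open>V f\<close> is a random sample containing each curve with probability
    1/K. An edge survives with probability K^-2, a vertex with K^-1, and a conflict with K^-4
    because its four curves are distinct. Every count is scaled by \<open>K ^ 4\<close> to stay in
    the naturals.\<close>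
  have cS: "card {f \<in> \<Omega>. e \<in> V f \<times> V f} * K ^ 4 = K ^ card B * K ^ 2" if "e \<in> S" for e
  proof -
    obtain b c where e: "e = (b, c)" by force
    have bc: "b \<in> B" "c \<in> B" "b \<noteq> c" using that S e by auto
    then have "{f \<in> \<Omega>. e \<in> V f \<times> V f} = {f \<in> \<Omega>. \<forall>y\<in>{b, c}. f y = 0}" by (auto simp: V_def e)
    moreover have "card {b, c} = 2" using bc by simp
    moreover have "card {f \<in> \<Omega>. \<forall>y\<in>{b, c}. f y = 0} * K ^ card {b, c} = K ^ card B"
      using bc by (intro cnt) auto
    ultimately have "card {f \<in> \<Omega>. e \<in> V f \<times> V f} * K ^ 2 = K ^ card B"
      by (simp only:)
    moreover have "K ^ 4 = K ^ 2 * K ^ 2" by (simp add: eval_nat_numeral)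
    ultimately show ?thesis by (simp only: mult.assoc[symmetric])
  qed
  have cX: "card {f \<in> \<Omega>. fst x \<in> V f \<times> V f \<and> snd x \<in> V f \<times> V f} * K ^ 4 = K ^ card B" if "x \<in> X" for x
  proof -
    obtain b b' c c' where x: "x = ((b, b'), (c, c'))" by (metis surj_pair)
    have m: "b \<in> B" "b' \<in> B" "c \<in> B" "c' \<in> B" using that X(1) S(1) x by auto
    then have "{f \<in> \<Omega>. fst x \<in> V f \<times> V f \<and> snd x \<in> V f \<times> V f} = {f \<in> \<Omega>. \<forall>y\<in>{b, b', c, c'}. f y = 0}"
      by (auto simp: V_def x)
    moreover have "card {f \<in> \<Omega>. \<forall>y\<in>{b, b', c, c'}. f y = 0} * K ^ card {b, b', c, c'} = K ^ card B"
      using m by (intro cnt) auto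
    moreover have "card {b, b', c, c'} = 4" using X(2) that x by blast
    ultimately show ?thesis by (simp only:)
  qed
  have cB: "card {f \<in> \<Omega>. b \<in> V f} * K ^ 4 = K ^ card B * K ^ 3" if "b \<in> B" for b
  proof -
    have "{f \<in> \<Omega>. b \<in> V f} = {f \<in> \<Omega>. \<forall>y\<in>{b}. f y = 0}" using that by (auto simp: V_def)
    moreover have "card {f \<in> \<Omega>. \<forall>y\<in>{b}. f y = 0} * K ^ card {b} = K ^ card B"
      using that by (intro cnt) auto
    ultimately have "card {f \<in> \<Omega>. b \<in> V f} * K = K ^ card B" by simp
    moreover have "K ^ 4 = K * K ^ 3" by (simp add: eval_nat_numeral)
    ultimately show ?thesis by (simp only: mult.assoc[symmetric])
  qed
  have "(\<Sum>f\<in>\<Omega>. card {e \<in> S. e \<in> V f \<times> V f}) \<le>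
     (\<Sum>f\<in>\<Omega>. 3 * card {b \<in> B. b \<in> V f} + card {x \<in> X. fst x \<in> V f \<times> V f \<and> snd x \<in> V f \<times> V f})"
  proof (rule sum_mono)
    fix f
    have "{b \<in> B. b \<in> V f} = V f" by (auto simp: V_def)
    then show "card {e \<in> S. e \<in> V f \<times> V f} \<le>
      3 * card {b \<in> B. b \<in> V f} + card {x \<in> X. fst x \<in> V f \<times> V f \<and> snd x \<in> V f \<times> V f}"
      using H[of "V f"] by (auto simp: V_def)
  qed
  then have "(\<Sum>e\<in>S. card {f \<in> \<Omega>. e \<in> V f \<times> V f}) \<le> 3 * (\<Sum>b\<in>B. card {f \<in> \<Omega>. b \<in> V f}) +
     (\<Sum>x\<in>X. card {f \<in> \<Omega>. fst x \<in> V f \<times> V f \<and> snd x \<in> V f \<times> V f})"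
    by (simp only: sum.distrib swap[OF fin(2)] swap[OF fin(3)] swap[OF B] flip: sum_distrib_left)
  then have "(\<Sum>e\<in>S. card {f \<in> \<Omega>. e \<in> V f \<times> V f}) * K ^ 4 \<le> (3 * (\<Sum>b\<in>B. card {f \<in> \<Omega>. b \<in> V f}) +
     (\<Sum>x\<in>X. card {f \<in> \<Omega>. fst x \<in> V f \<times> V f \<and> snd x \<in> V f \<times> V f})) * K ^ 4"
    by (rule mult_right_mono) simp
  moreover have "(\<Sum>e\<in>S. card {f \<in> \<Omega>. e \<in> V f \<times> V f}) * K ^ 4 = (\<Sum>e\<in>S. K ^ card B * K ^ 2)"
    unfolding sum_distrib_right by (rule sum.cong[OF refl cS])
  moreover have "(\<Sum>b\<in>B. card {f \<in> \<Omega>. b \<in> V f}) * K ^ 4 = (\<Sum>b\<in>B. K ^ card B * K ^ 3)"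
    unfolding sum_distrib_right by (rule sum.cong[OF refl cB])
  moreover have "(\<Sum>x\<in>X. card {f \<in> \<Omega>. fst x \<in> V f \<times> V f \<and> snd x \<in> V f \<times> V f}) * K ^ 4 = (\<Sum>x\<in>X. K ^ card B)"
    unfolding sum_distrib_right by (rule sum.cong[OF refl cX])
  ultimately have "(\<Sum>e\<in>S. K ^ card B * K ^ 2) \<le> 3 * (\<Sum>b\<in>B. K ^ card B * K ^ 3) + (\<Sum>x\<in>X. K ^ card B)"
    by (simp only: add_mult_distrib mult.assoc)
  then have "card S * (K ^ card B * K ^ 2) \<le> 3 * (card B * (K ^ card B * K ^ 3)) + card X * K ^ card B"
    by (simp only: sum_constant of_nat_id)
  then have "(card S * K ^ 2) * K ^ card B \<le> (3 * card B * K ^ 3 + card X) * K ^ card B"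
    by (simp only: add_mult_distrib mult.assoc mult.commute[of "K ^ card B"])
  moreover have "0 < K ^ card B" using K by simp
  ultimately show ?thesis by (simp only: mult_le_cancel2)
qed

text \<open>Dividing by \<open>(M ^ 3) ^ g\<close> leaves (1 + 1/M^3)^g \<le> M^24. By Bernoulli
  each block of \<open>M ^ 3\<close> factors contributes at least 2, so 24 M blocks give at least
  2^(24 M), which exceeds M^24 since M < 2^M. This crude estimate stands in for a logarithm.\<close>

lemma power_ratio_bound:
  fixes M g :: nat
  assumes "M \<ge> 1" "(M ^ 3 + 1) ^ g \<le> (M ^ 3) ^ g * M ^ 24"
  shows "g \<le> 24 * M ^ 4"
proof (rule ccontr)
  assume "\<not> ?thesis"
  then have g: "24 * M ^ 4 \<le> g" by simp
  define x :: real where "x = 1 + 1 / real (M ^ 3)"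
  have x1: "x \<ge> 1" by (simp add: x_def)
  have "x = real (M ^ 3 + 1) / real (M ^ 3)" using assms(1) by (simp add: x_def field_simps)
  then have "x ^ g = real ((M ^ 3 + 1) ^ g) / real ((M ^ 3) ^ g)"
    by (simp only: power_divide of_nat_power)
  also have "\<dots> \<le> real ((M ^ 3) ^ g * M ^ 24) / real ((M ^ 3) ^ g)"
    by (intro divide_right_mono of_nat_mono assms) simp
  also have "\<dots> = real M ^ 24" using assms(1) by simp
  finally have 1: "x ^ g \<le> real M ^ 24" .
  have "- 1 \<le> 1 / real (M ^ 3)" by (rule order_trans[of _ 0]) auto
  then have "2 \<le> x ^ (M ^ 3)"
    using Bernoulli_inequality[of "1 / real (M ^ 3)" "M ^ 3"] assms(1) by (simp add: x_def)
  then have "2 ^ (24 * M) \<le> (x ^ (M ^ 3)) ^ (24 * M)" by (intro power_mono) auto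
  also have "\<dots> = x ^ (24 * M ^ 4)"
  proof -
    have "M ^ 4 = M ^ 3 * M" by (simp add: eval_nat_numeral)
    then have "24 * M ^ 4 = M ^ 3 * (24 * M)" by simp
    then show ?thesis by (simp only: power_mult)
  qed
  also have "\<dots> \<le> x ^ g" using g x1 by (rule power_increasing)
  finally have "2 ^ (24 * M) \<le> real M ^ 24" using 1 by linarith
  moreover have "(2 :: real) ^ (24 * M) = (2 ^ M) ^ 24" by (subst mult.commute) (rule power_mult)
  moreover have "real M < 2 ^ M" by (rule of_nat_less_two_power)
  then have "real M ^ 24 < (2 ^ M) ^ 24" by (intro power_strict_mono) auto
  ultimately show False by linarith
qed

text \<open>Cut the range from 1 to \<open>\<rho> ^ 8\<close> at the powers of \<rho>: two weights
  whose ratio exceeds \<rho> never fall into the same one of the nine levels 0 to 8.\<close>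

lemma geometric_card_bound:
  fixes w :: "'x \<Rightarrow> nat" and \<rho> :: nat
  assumes "finite S" "\<And>x. x \<in> S \<Longrightarrow> 1 \<le> w x \<and> w x \<le> \<rho> ^ 8" "\<rho> \<ge> 1"
    and sep: "\<And>x y. x \<in> S \<Longrightarrow> y \<in> S \<Longrightarrow> x \<noteq> y \<Longrightarrow> \<rho> * w x < w y \<or> \<rho> * w y < w x"
  shows "card S \<le> 9"
proof -
  define lev where "lev m = (LEAST i. m \<le> \<rho> ^ i)" for m
  have lt: "lev m < lev n" if "\<rho> * m < n" "1 \<le> m" "n \<le> \<rho> ^ 8" for m n
  proof -
    have n: "n \<le> \<rho> ^ lev n" unfolding lev_def using that by (rule_tac LeastI)
    have "1 * 1 \<le> \<rho> * m" using that assms(3) by (intro mult_mono) auto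
    then have "1 < n" using that by linarith
    then have "lev n \<noteq> 0" using n by (cases "lev n = 0") auto
    then obtain k where k: "lev n = Suc k" by (cases "lev n") auto
    then have "n \<le> \<rho> * \<rho> ^ k" using n by simp
    then have "\<rho> * m < \<rho> * \<rho> ^ k" using that by linarith
    then have "m \<le> \<rho> ^ k" by simp
    then have "lev m \<le> k" unfolding lev_def by (rule Least_le)
    then show ?thesis using k by simp
  qed
  have "inj_on (\<lambda>x. lev (w x)) S"
  proof (rule inj_onI, rule ccontr)
    fix x y assume "x \<in> S" "y \<in> S" "lev (w x) = lev (w y)" "x \<noteq> y"
    then show False using sep[of x y] lt[of "w x" "w y"] lt[of "w y" "w x"] assms(2) by auto
  qed
  moreover have "(\<lambda>x. lev (w x)) ` S \<subseteq> {..8}"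
    using assms(2) by (auto simp: lev_def intro: Least_le)
  ultimately show ?thesis using card_inj_on_le[of "\<lambda>x. lev (w x)" S "{..8}"] by simp
qed

lemma graphs_meet:
  fixes f g :: "real \<Rightarrow> real"
  assumes "continuous_on {s..u} f" "continuous_on {s..u} g" "s \<le> u" "f s \<le> g s" "g u \<le> f u"
  shows "\<exists>z. s \<le> z \<and> z \<le> u \<and> f z = g z"
  using IVT'[of "\<lambda>x. f x - g x" s 0 u] continuous_on_diff[OF assms(1,2)] assms by auto

section \<open>Curves as functions, and reachability\<close>

text \<open>Curves are labels with a height function \<open>F c\<close> on the times from
  \<open>s0\<close> to \<open>E c\<close>. Of tangency two consequences are kept: the curves meet,
  and the lower one never gets above the upper one. Both survive the reflection of \<open>F\<close>
  to its negative with \<open>A\<close> and \<open>B\<close> exchanged, which yields the symmetric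
  half of the count.\<close>

locale tangency_family =
  fixes A B :: "'c set" and F :: "'c \<Rightarrow> real \<Rightarrow> real" and E :: "'c \<Rightarrow> real"
    and s0 :: real and touches :: "'c \<Rightarrow> 'c \<Rightarrow> bool"
  assumes finA: "finite A" and finB: "finite B" and disj: "A \<inter> B = {}"
    and start: "c \<in> A \<union> B \<Longrightarrow> s0 \<le> E c"
    and cont: "c \<in> A \<union> B \<Longrightarrow> continuous_on {s0..E c} (F c)"
    and once: "\<lbrakk>c \<in> A \<union> B; d \<in> A \<union> B; c \<noteq> d; s0 \<le> s; s \<le> E c; s \<le> E d;
        s0 \<le> u; u \<le> E c; u \<le> E d; F c s = F d s; F c u = F d u\<rbrakk> \<Longrightarrow> s = u"
    and triple: "\<lbrakk>c \<in> A \<union> B; d \<in> A \<union> B; g \<in> A \<union> B; c \<noteq> d; c \<noteq> g; d \<noteq> g; s0 \<le> s;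
        s \<le> E c; s \<le> E d; s \<le> E g; F c s = F d s; F c s = F g s\<rbrakk> \<Longrightarrow> False"
    and init: "\<lbrakk>c \<in> A \<union> B; d \<in> A \<union> B; F c s0 = F d s0\<rbrakk> \<Longrightarrow> c = d"
    and AB: "\<lbrakk>a \<in> A; b \<in> B\<rbrakk> \<Longrightarrow> F a s0 < F b s0"
    and touches_mem: "touches a b \<Longrightarrow> a \<in> A \<and> b \<in> B"
    and touches_le: "\<lbrakk>touches a b; s0 \<le> s; s \<le> E a; s \<le> E b\<rbrakk> \<Longrightarrow> F a s \<le> F b s"
    and touches_eq: "touches a b \<Longrightarrow> \<exists>s. s0 \<le> s \<and> s \<le> E a \<and> s \<le> E b \<and> F a s = F b s"
begin

definition ini :: "'c \<Rightarrow> 'c \<Rightarrow> bool" where "ini c d \<longleftrightarrow> F c s0 < F d s0"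

lemma ini_trans: "ini c d \<Longrightarrow> ini d g \<Longrightarrow> ini c g"
  by (simp add: ini_def)

lemma ini_neq: "ini c d \<Longrightarrow> c \<noteq> d"
  by (auto simp: ini_def)

lemma ini_asym: "ini c d \<Longrightarrow> \<not> ini d c"
  by (simp add: ini_def)

lemma ini_total: "c \<in> A \<union> B \<Longrightarrow> d \<in> A \<union> B \<Longrightarrow> c \<noteq> d \<Longrightarrow> ini c d \<or> ini d c"
  using init unfolding ini_def by (meson linorder_less_linear)

section \<open>Order of two curves before and after their common point\<close>

lemma zero_between:
  assumes "c \<in> A \<union> B" "d \<in> A \<union> B" "s0 \<le> s" "s \<le> u" "u \<le> E c" "u \<le> E d"
    and "F c s \<le> F d s" "F d u \<le> F c u"
  shows "\<exists>z. s \<le> z \<and> z \<le> u \<and> F c z = F d z"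
  using assms by (intro graphs_meet continuous_on_subset[OF cont]) auto

text \<open>Each change of order costs a common point, and there is only one. The same argument
  excludes equality at \<open>u\<close>, so the conclusion is strict.\<close>

lemma flip:
  assumes "c \<in> A \<union> B" "d \<in> A \<union> B" "s0 \<le> s" "s \<le> s'" "s' \<le> u" "u \<le> E c" "u \<le> E d"
    and "F c s < F d s" "F d s' < F c s'"
  shows "F d u < F c u"
proof (rule ccontr)
  assume "\<not> F d u < F c u"
  obtain z where z: "s \<le> z" "z \<le> s'" "F c z = F d z"
    using zero_between[of c d s s'] assms by force
  obtain y where y: "s' \<le> y" "y \<le> u" "F d y = F c y"
    using zero_between[of d c s' u] assms \<open>\<not> F d u < F c u\<close> by force
  have "z = y"
    using once[of c d z y] assms z y by auto
  with z y assms show False by (smt (verit))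
qed

lemma flip_ini:
  assumes "c \<in> A \<union> B" "d \<in> A \<union> B" "ini c d" "s0 \<le> s" "s \<le> u" "u \<le> E c" "u \<le> E d" "F d s < F c s"
  shows "F d u < F c u"
  using flip[of c d s0 s u] assms by (auto simp: ini_def)

lemma after_zero:
  assumes "c \<in> A \<union> B" "d \<in> A \<union> B" "ini c d" "s0 \<le> z" "z < u" "u \<le> E c" "u \<le> E d"
    and "F c z = F d z" and v: "s0 \<le> v" "v \<le> E c" "v \<le> E d" "F d v < F c v"
  shows "F d u < F c u"
proof (cases "v \<le> u")
  case True
  then show ?thesis using flip_ini[of c d v u] assms by auto
next
  case False
  show ?thesis
  proof (rule ccontr)
    assume n: "\<not> ?thesis"
    obtain y where y: "u \<le> y" "y \<le> v" "F c y = F d y"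
      using zero_between[of c d u v] assms n False by force
    have "z = y" using once[of c d z y] assms y ini_neq by auto
    then show False using y assms by auto
  qed
qed

lemma before_zero:
  assumes "c \<in> A \<union> B" "d \<in> A \<union> B" "ini c d" "s0 \<le> u" "u < z" "z \<le> E c" "z \<le> E d"
    and "F c z = F d z"
  shows "F c u < F d u"
proof (rule ccontr)
  assume n: "\<not> ?thesis"
  obtain y where y: "s0 \<le> y" "y \<le> u" "F c y = F d y"
    using zero_between[of c d s0 u] assms n by (force simp: ini_def)
  have "z = y" using once[of c d z y] assms y ini_neq by auto
  then show False using y assms by auto
qed

text \<open>The inequality is asked at some \<open>v\<close> up to \<open>s\<close>, not at
  \<open>s\<close> itself: the fact that \<open>z\<close> has fallen below \<open>x\<close> then
  persists when either curve ends, and the relation grows with \<open>s\<close>.\<close>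

definition step :: "real \<Rightarrow> 'c \<Rightarrow> 'c \<Rightarrow> bool" where
  "step s x z \<longleftrightarrow> x \<in> B \<and> z \<in> B \<and> ini x z \<and>
     (\<exists>v. s0 \<le> v \<and> v \<le> s \<and> v \<le> E x \<and> v \<le> E z \<and> F z v < F x v)"

text \<open>Reachability replaces the direct comparison of two curves at time \<open>s\<close>, because a curve may have
  ended before; for curves alive at time \<open>s\<close> the two agree.\<close>
definition reach :: "real \<Rightarrow> 'c \<Rightarrow> 'c \<Rightarrow> bool" where
  "reach s = (step s)\<^sup>+\<^sup>+"

lemma step_ini: "step s x z \<Longrightarrow> ini x z" by (simp add: step_def)

lemma stepI:
  "\<lbrakk>x \<in> B; z \<in> B; ini x z; s0 \<le> v; v \<le> s; v \<le> E x; v \<le> E z; F z v < F x v\<rbrakk> \<Longrightarrow> step s x z"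
  by (auto simp: step_def)

lemma reach_step: "step s x z \<Longrightarrow> reach s x z" by (simp add: reach_def)

lemma reach_extend: "x = c \<or> reach s c x \<Longrightarrow> step s x z \<Longrightarrow> reach s c z"
  unfolding reach_def by (auto intro: tranclp.intros)

lemma reach_ini: "reach s x z \<Longrightarrow> ini x z"
  unfolding reach_def by (induction rule: tranclp_induct) (auto intro: ini_trans step_ini)

lemma reach_mem: assumes "reach s x z" shows "x \<in> B" "z \<in> B"
proof -
  show "x \<in> B" using assms unfolding reach_def by (auto simp: step_def dest: tranclpD)
  show "z \<in> B" using assms unfolding reach_def by (induction rule: tranclp_induct) (auto simp: step_def)
qed

lemma step_mono: "step s x z \<Longrightarrow> s \<le> s' \<Longrightarrow> step s' x z"
  unfolding step_def by force

lemma reach_mono: "reach s x z \<Longrightarrow> s \<le> s' \<Longrightarrow> reach s' x z"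
  unfolding reach_def
  by (induction rule: tranclp_induct) (auto intro: tranclp.intros step_mono)

lemma reach_pred: "reach s c z \<Longrightarrow> \<exists>x. (x = c \<or> reach s c x) \<and> step s x z"
  unfolding reach_def by (metis tranclp.cases)

definition ini_rank :: "'c \<Rightarrow> nat" where
  "ini_rank x = card {d \<in> B. ini d x}"

lemma ini_rank_less: "ini x y \<Longrightarrow> x \<in> B \<Longrightarrow> ini_rank x < ini_rank y"
  unfolding ini_rank_def using finB
  by (intro psubset_card_mono) (auto intro: ini_trans dest: ini_asym ini_neq)

text \<open>When a dominating curve ends, it is itself dominated by one of its predecessors on the path
  from \<open>c\<close>.\<close>
lemma reach_dominate:
  assumes "c \<in> B" "x = c \<or> reach s c x" "z \<in> A \<union> B" "ini x z" "s0 \<le> v" "v \<le> u" "u \<le> s"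
    "v \<le> E x" "u \<le> E c" "u \<le> E z" "F z v < F x v"
  shows "\<exists>y. (y = c \<or> reach s c y) \<and> u \<le> E y \<and> (y = x \<or> ini y x) \<and> F z u < F y u"
proof -
  show ?thesis using assms
  proof (induction "ini_rank x" arbitrary: x z v u rule: less_induct)
    case less
    have xB: "x \<in> B" using less.prems reach_mem by auto
    show ?case
    proof (cases "u \<le> E x")
      case True
      have "F z u < F x u"
        using flip_ini[of x z v u] less.prems xB True by auto
      then show ?thesis using less.prems True by blast
    next
      case False
      then have "reach s c x" using less.prems by auto
      then obtain x0 where x0: "x0 = c \<or> reach s c x0" "step s x0 x"
        using reach_pred by blast
      then obtain v0 where v0: "s0 \<le> v0" "v0 \<le> s" "v0 \<le> E x0" "v0 \<le> E x" "F x v0 < F x0 v0"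
        "ini x0 x" "x0 \<in> B" by (auto simp: step_def)
      \<comment> \<open>The induction is used twice, for curves of smaller initial rank than
        \<open>x\<close>: here to find a curve \<open>y\<close> above \<open>x\<close> at the moment
        \<open>x\<close> ends, and then to carry \<open>z\<close>, which is below \<open>y\<close>
        at that moment, on to \<open>u\<close>.\<close>
      have "\<exists>y. (y = c \<or> reach s c y) \<and> E x \<le> E y \<and> (y = x0 \<or> ini y x0) \<and> F x (E x) < F y (E x)"
        using less.prems False v0 x0 xB
        by (intro less.hyps[of x0 x v0 "E x"] ini_rank_less) auto
      then obtain y where y: "y = c \<or> reach s c y" "E x \<le> E y" "y = x0 \<or> ini y x0"
        "F x (E x) < F y (E x)" by blast
      have yx: "ini y x" using y v0 ini_trans by blast
      have yB: "y \<in> B" using y less.prems reach_mem by auto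
      have "F z (E x) < F x (E x)"
        using flip_ini[of x z v "E x"] less.prems xB False by auto
      then have zy: "F z (E x) < F y (E x)" using y by simp
      have "\<exists>y'. (y' = c \<or> reach s c y') \<and> u \<le> E y' \<and> (y' = y \<or> ini y' y) \<and> F z u < F y' u"
        using less.prems False y yx yB zy ini_trans[OF yx, of z] start[of x] xB
        by (intro less.hyps[of y z "E x" u] ini_rank_less) auto
      then show ?thesis using yx ini_trans by blast
    qed
  qed
qed

text \<open>The last curve before \<open>z\<close> on the path may have ended, but
  \<open>reach_dominate\<close> supplies a curve alive at \<open>s\<close> that is above
  \<open>z\<close> and started below it. Descending in the initial order in this way ends at
  \<open>c\<close>.\<close>

lemma reach_alive:
  assumes "reach s c z" "s0 \<le> s" "s \<le> E z" "s \<le> E c"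
  shows "F z s < F c s"
proof -
  show ?thesis using assms
  proof (induction "ini_rank z" arbitrary: z rule: less_induct)
    case less
    obtain x where x: "x = c \<or> reach s c x" "step s x z"
      using reach_pred less.prems by blast
    then obtain v where v: "s0 \<le> v" "v \<le> s" "v \<le> E x" "v \<le> E z" "F z v < F x v"
      "ini x z" "x \<in> B" "z \<in> B" by (auto simp: step_def)
    obtain y where y: "y = c \<or> reach s c y" "s \<le> E y" "y = x \<or> ini y x" "F z s < F y s"
      using reach_dominate[of c x s z v s] x v less.prems reach_mem(1)[OF less.prems(1)] by auto
    have yz: "ini y z" using y v ini_trans by blast
    have yB: "y \<in> B" using y less.prems reach_mem by auto
    show ?case
    proof (cases "y = c")
      case False
      then have "F y s < F c s"
        using y less.prems yz yB by (intro less.hyps ini_rank_less) auto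
      then show ?thesis using y by simp
    qed (use y in simp)
  qed
qed

section \<open>Sets of edges without crossings\<close>

definition cross_time :: "'c \<Rightarrow> 'c \<Rightarrow> real" where
  "cross_time b b' = (SOME s. s0 \<le> s \<and> s \<le> E b \<and> s \<le> E b' \<and> F b s = F b' s)"

definition crossing_pair :: "'c \<Rightarrow> 'c \<Rightarrow> bool" where
  "crossing_pair b b' \<longleftrightarrow> b \<in> B \<and> b' \<in> B \<and> ini b b' \<and>
     (\<exists>v. s0 \<le> v \<and> v \<le> E b \<and> v \<le> E b' \<and> F b' v < F b v)"

lemma cross_time_props:
  assumes "crossing_pair b b'"
  shows "s0 \<le> cross_time b b'" "cross_time b b' < E b" "cross_time b b' < E b'"
    "F b (cross_time b b') = F b' (cross_time b b')"
proof -
  obtain v where v: "s0 \<le> v" "v \<le> E b" "v \<le> E b'" "F b' v < F b v"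
    and m: "b \<in> B" "b' \<in> B" "ini b b'" using assms by (auto simp: crossing_pair_def)
  obtain z where z: "s0 \<le> z" "z \<le> v" "F b z = F b' z"
    using zero_between[of b b' s0 v] m v by (force simp: ini_def)
  then have "\<exists>s. s0 \<le> s \<and> s \<le> E b \<and> s \<le> E b' \<and> F b s = F b' s"
    using v by (intro exI[of _ z]) auto
  from someI_ex[OF this] have c: "s0 \<le> cross_time b b'" "cross_time b b' \<le> E b"
    "cross_time b b' \<le> E b'" "F b (cross_time b b') = F b' (cross_time b b')"
    by (auto simp: cross_time_def)
  have "z = cross_time b b'"
    using once[of b b' z "cross_time b b'"] c z v m ini_neq by auto
  moreover have "z \<noteq> v" using z v by auto
  ultimately show "s0 \<le> cross_time b b'" "cross_time b b' < E b" "cross_time b b' < E b'"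
    "F b (cross_time b b') = F b' (cross_time b b')" using c z v by auto
qed

lemma cross_after:
  assumes "crossing_pair b b'" "cross_time b b' < u" "u \<le> E b" "u \<le> E b'"
  shows "F b' u < F b u"
  using assms cross_time_props[OF assms(1)]
  by (auto simp: crossing_pair_def intro: after_zero[of b b' "cross_time b b'" u])

lemma cross_before:
  assumes "crossing_pair b b'" "s0 \<le> u" "u < cross_time b b'"
  shows "F b u < F b' u"
  using assms cross_time_props[OF assms(1)]
  by (intro before_zero[of b b' u "cross_time b b'"]) (auto simp: crossing_pair_def)

lemma cross_step:
  assumes "crossing_pair b b'" "cross_time b b' < s"
  shows "step s b b'"
proof -
  note z = cross_time_props[OF assms(1)]
  define v where "v = min s (min (E b) (E b'))"
  show ?thesis
    using cross_after[OF assms(1), of v] z assms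
    by (intro stepI[of _ _ v]) (auto simp: v_def crossing_pair_def)
qed

text \<open>The end \<open>b'\<close> of an edge lies on the edge and does not count as below it,
  even at the crossing time itself. For this reason the end of an edge appears as a separate
  alternative next to \<open>reach\<close> in conflicts and wedges.\<close>

lemma not_reach_cross:
  assumes "crossing_pair b b'" "s \<le> cross_time b b'" "s0 \<le> s"
  shows "\<not> reach s b b'"
proof
  assume "reach s b b'"
  note z = cross_time_props[OF assms(1)]
  have "F b' s < F b s" using reach_alive[OF \<open>reach s b b'\<close>] z assms by auto
  moreover have "F b s \<le> F b' s"
    using cross_before[OF assms(1), of s] z assms by (cases "s = cross_time b b'") auto
  ultimately show False by simp
qed

text \<open>The curves of \<open>B\<close> are treated like the points of a planar drawing, ordered by their initial
  heights, with the pair \<open>b\<close>, \<open>b'\<close> as an edge of slope \<open>cross_time b b'\<close>; \<open>reach (cross_time b b') b\<close>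
  then is the set of points below that edge. The following two relations express that two edges
  cross, the second edge starting below (respectively above) the first.\<close>
definition up_conflict :: "'c \<times> 'c \<Rightarrow> 'c \<times> 'c \<Rightarrow> bool" where
  "up_conflict e f \<longleftrightarrow> (case (e, f) of ((b, b'), (c, c')) \<Rightarrow> \<exists>w\<in>B. ini b c \<and> ini c w \<and>
     (w = b' \<or> ini w b') \<and> (w = c' \<or> ini w c') \<and> \<not> (w = b' \<and> w = c') \<and>
     reach (cross_time b b') b c \<and> (reach (cross_time c c') c w \<or> w = c') \<and>
     \<not> reach (cross_time b b') b w)"

definition down_conflict :: "'c \<times> 'c \<Rightarrow> 'c \<times> 'c \<Rightarrow> bool" where
  "down_conflict e f \<longleftrightarrow> (case (e, f) of ((b, b'), (c, c')) \<Rightarrow> \<exists>w\<in>B. ini b c \<and> ini c w \<and>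
     (w = b' \<or> ini w b') \<and> (w = c' \<or> ini w c') \<and> \<not> (w = b' \<and> w = c') \<and>
     \<not> reach (cross_time b b') b c \<and> (reach (cross_time b b') b w \<or> w = b') \<and>
     \<not> reach (cross_time c c') c w)"

lemma cross_time_inj:
  assumes "crossing_pair b c" "crossing_pair b d" "cross_time b c = cross_time b d"
  shows "c = d"
proof (rule ccontr)
  assume "c \<noteq> d"
  then show False
    using triple[of b c d "cross_time b c"] assms cross_time_props[OF assms(1)]
      cross_time_props[OF assms(2)] ini_neq by (auto simp: crossing_pair_def)
qed

definition wedge :: "'c set \<Rightarrow> 'c \<Rightarrow> 'c \<Rightarrow> 'c \<Rightarrow> 'c \<Rightarrow> bool" where
  "wedge V b c d w \<longleftrightarrow> w \<in> V \<and> (reach (cross_time b d) b w \<or> w = d) \<and> \<not> reach (cross_time b c) b w"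

text \<open>A wedge between two consecutive edges at \<open>b\<close> is charged to its initially lowest vertex \<open>w\<close>; the
  flag records whether \<open>w\<close> is the end of the lower edge.\<close>
lemma wedge_charge_inj:
  assumes V: "V \<subseteq> B"
    and cp: "crossing_pair b c" "crossing_pair b d" "crossing_pair p q" "crossing_pair p r"
    and cr: "c \<in> V" "d \<in> V" "q \<in> V" "r \<in> V" "b \<in> V" "p \<in> V"
    and lt: "cross_time b c < cross_time b d" "cross_time p q < cross_time p r"
    and w1: "wedge V b c d w" "\<And>x. wedge V b c d x \<Longrightarrow> \<not> ini x w"
    and w2: "wedge V p q r w" "\<And>x. wedge V p q r x \<Longrightarrow> \<not> ini x w"
    and nc: "\<not> up_conflict (b, c) (p, r)" "\<not> down_conflict (b, d) (p, q)"
    and flag: "(w = c) = (w = q)"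
  shows "\<not> ini b p"
proof
  assume bp: "ini b p"
  have wV: "w \<in> V" "w \<in> B" using w1 V by (auto simp: wedge_def)
  note z1 = cross_time_props[OF cp(1)] and z3 = cross_time_props[OF cp(3)]
  have st: "reach (cross_time b d) b c" "reach (cross_time p r) p q"
    using cross_step cp lt reach_step by auto
  have "wedge V b c d c" "wedge V b c d d" "wedge V p q r q" "wedge V p q r r"
    using st cr not_reach_cross[OF cp(1)] not_reach_cross[OF cp(2), of "cross_time b c"]
      not_reach_cross[OF cp(3)] not_reach_cross[OF cp(4), of "cross_time p q"] lt z1 z3
    by (auto simp: wedge_def)
  then have o: "w = c \<or> ini w c" "w = d \<or> ini w d" "w = q \<or> ini w q" "w = r \<or> ini w r"
    using w1(2) w2(2) ini_total V wV cr by (meson UnI2 subsetD)+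
  have pw: "ini p w"
    using w2(1) cp(4) reach_ini by (auto simp: wedge_def crossing_pair_def)
  have ne: "c \<noteq> d" "q \<noteq> r" using lt by auto
  \<comment> \<open>As \<open>p\<close> starts below \<open>w\<close>, minimality of
    \<open>w\<close> keeps \<open>p\<close> out of the wedge at \<open>b\<close>: it is below both
    edges of that wedge or below neither. In the first case \<open>w\<close> witnesses that the
    lower edge at \<open>b\<close> crosses the upper edge at \<open>p\<close>, in the second that
    the upper edge at \<open>b\<close> crosses the lower edge at \<open>p\<close>, unless
    \<open>w\<close> is a common end of the two edges, which the flags exclude.\<close>
  show False
  proof (cases "reach (cross_time b c) b p")
    case True
    have "w = c \<and> w = r"
      using nc(1) True bp pw o wV w1(1) w2(1) unfolding up_conflict_def wedge_def by auto
    then show False using flag ne by auto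
  next
    case False
    then have "\<not> wedge V b c d p" using w1(2) pw by auto
    then have "\<not> reach (cross_time b d) b p"
      using False cr by (auto simp: wedge_def)
    then have "w = d \<and> w = q"
      using nc(2) bp pw o wV w1(1) w2(1) unfolding down_conflict_def wedge_def by auto
    then show False using flag ne by auto
  qed
qed

text \<open>Wedges at the same curve \<open>b\<close> that follow one another in slope share at most
  the end of a common boundary edge, here \<open>d = q\<close>. It ends the upper edge of one wedge
  and the lower edge of the other, so the flag tells the two apart.\<close>

lemma wedge_charge_inj_same:
  assumes cp: "crossing_pair b c" "crossing_pair b d" "crossing_pair b q" "crossing_pair b r"
    and lt: "cross_time b c < cross_time b d" "cross_time b d \<le> cross_time b q"
    and w1: "wedge V b c d w" and w2: "wedge V b q r w"
    and flag: "(w = c) = (w = q)"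
  shows False
proof -
  have "\<not> reach (cross_time b d) b w"
    using w2 lt reach_mono unfolding wedge_def by blast
  then have wd: "w = d" using w1 by (auto simp: wedge_def)
  have "cross_time b d = cross_time b q"
    using w2 lt wd cross_step[OF cp(2), of "cross_time b q"] reach_step
    unfolding wedge_def by force
  then have "d = q" using cross_time_inj cp by blast
  then show False using wd flag lt by auto
qed

text \<open>At each curve at most one edge has no later edge, which gives \<open>card V\<close>. Any
  other edge bounds a wedge with its successor \<open>nx\<close>, and its charge, the lowest curve
  of that wedge together with the flag, has at most \<open>2 * card V\<close> values.\<close>

lemma conflict_free_bound:
  assumes V: "V \<subseteq> B" and S: "S \<subseteq> V \<times> V" and cp: "\<And>b c. (b, c) \<in> S \<Longrightarrow> crossing_pair b c"
    and nc: "\<And>e f. e \<in> S \<Longrightarrow> f \<in> S \<Longrightarrow> \<not> up_conflict e f \<and> \<not> down_conflict e f"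
  shows "card S \<le> 3 * card V"
proof -
  have finV: "finite V" using V finB finite_subset by blast
  have finS: "finite S" using S finV finite_subset by blast
  define later where "later = (\<lambda>(b, c). {d. (b, d) \<in> S \<and> cross_time b c < cross_time b d})"
  define S1 where "S1 = {e \<in> S. later e = {}}"
  define S2 where "S2 = {e \<in> S. later e \<noteq> {}}"
  have "inj_on fst S1"
  proof (rule inj_onI, clarify)
    fix b c b' d assume *: "(b, c) \<in> S1" "(b', d) \<in> S1" "fst (b, c) = fst (b', d)"
    then have "cross_time b c = cross_time b d"
      by (auto simp: S1_def later_def) (meson linorder_less_linear)
    then show "b = b' \<and> c = d"
      using * cross_time_inj[OF cp cp] by (fastforce simp: S1_def)
  qed
  then have c1: "card S1 \<le> card V"
    using S finV by (intro card_inj_on_le[of fst]) (auto simp: S1_def)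
  define nx where "nx = (\<lambda>(b, c). arg_min_on (cross_time b) (later (b, c)))"
  have fl: "finite (later e)" for e
  proof -
    have "later e \<subseteq> snd ` S" by (force simp: later_def split: prod.splits)
    then show ?thesis using finS finite_subset by blast
  qed
  have nx: "nx (b, c) \<in> later (b, c)" "\<And>d. d \<in> later (b, c) \<Longrightarrow> cross_time b (nx (b, c)) \<le> cross_time b d"
    if "(b, c) \<in> S2" for b c
  proof -
    have ne: "later (b, c) \<noteq> {}" using that by (auto simp: S2_def)
    show "nx (b, c) \<in> later (b, c)"
      unfolding nx_def using arg_min_if_finite(1)[OF fl ne] by simp
    show "cross_time b (nx (b, c)) \<le> cross_time b d" if "d \<in> later (b, c)" for d
      unfolding nx_def using arg_min_least[OF fl ne that] by simp
  qed
  define wm where "wm = (\<lambda>(b, c). arg_min_on (\<lambda>x. F x s0) {x. wedge V b c (nx (b, c)) x})"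
  have wm: "wedge V b c (nx (b, c)) (wm (b, c))"
    "\<And>x. wedge V b c (nx (b, c)) x \<Longrightarrow> \<not> ini x (wm (b, c))"
    if e: "(b, c) \<in> S2" for b c
  proof -
    have f: "finite {x. wedge V b c (nx (b, c)) x}"
      using finV by (rule finite_subset[rotated]) (auto simp: wedge_def)
    have d: "(b, nx (b, c)) \<in> S" "cross_time b c < cross_time b (nx (b, c))"
      using nx(1)[OF e] by (auto simp: later_def)
    have bc: "(b, c) \<in> S" using e by (simp add: S2_def)
    have "wedge V b c (nx (b, c)) (nx (b, c))"
      using d S cp[OF bc] not_reach_cross[OF cp[OF d(1)], of "cross_time b c"] cross_time_props(1)
      by (auto simp: wedge_def)
    then have ne: "{x. wedge V b c (nx (b, c)) x} \<noteq> {}" by blast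
    show "wedge V b c (nx (b, c)) (wm (b, c))"
      unfolding wm_def using arg_min_if_finite(1)[OF f ne] by simp
    show "\<not> ini x (wm (b, c))" if "wedge V b c (nx (b, c)) x" for x
      unfolding wm_def ini_def using arg_min_least[OF f ne, of x "\<lambda>x. F x s0"] that by simp
  qed
  have "inj_on (\<lambda>(b, c). (wm (b, c), wm (b, c) = c)) S2"
  proof (rule inj_onI, clarify)
    fix b c p q assume e: "(b, c) \<in> S2" and f: "(p, q) \<in> S2" and w: "wm (b, c) = wm (p, q)"
      and fl: "(wm (b, c) = c) = (wm (p, q) = q)"
    define d r where "d = nx (b, c)" and "r = nx (p, q)"
    have bd: "(b, d) \<in> S" "cross_time b c < cross_time b d" using nx(1)[OF e] by (auto simp: later_def d_def)
    have pr: "(p, r) \<in> S" "cross_time p q < cross_time p r" using nx(1)[OF f] by (auto simp: later_def r_def)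
    have bc: "(b, c) \<in> S" "(p, q) \<in> S" using e f by (auto simp: S2_def)
    have V4: "c \<in> V" "d \<in> V" "q \<in> V" "r \<in> V" "b \<in> V" "p \<in> V" using bd pr bc S by auto
    have "\<not> ini b p"
      using nc bc bd pr wm[OF e] wm[OF f] w fl
      by (intro wedge_charge_inj[of V b c d p q r "wm (b, c)"] V cp V4) (auto simp: d_def r_def)
    moreover have "\<not> ini p b"
      using nc bc bd pr wm[OF e] wm[OF f] w fl
      by (intro wedge_charge_inj[of V p q r b c d "wm (b, c)"] V cp V4) (auto simp: d_def r_def)
    ultimately have bp: "b = p" using ini_total V4 V by blast
    have "c = q"
    proof (rule ccontr)
      assume "c \<noteq> q"
      then consider "cross_time b c < cross_time b q" | "cross_time b q < cross_time b c"
        using cross_time_inj cp bc bp by (metis linorder_less_linear)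
      then show False
      proof cases
        case 1
        then have "cross_time b d \<le> cross_time b q"
          using nx(2)[OF e, of q] bc bp by (auto simp: later_def d_def)
        then show False
          using wedge_charge_inj_same[of b c d q r V "wm (b, c)"] cp bc bd pr bp wm[OF e] wm[OF f] w fl
          by (auto simp: d_def r_def)
      next
        case 2
        then have "cross_time b r \<le> cross_time b c"
          using nx(2)[OF f, of c] bc bp by (auto simp: later_def r_def)
        then show False
          using wedge_charge_inj_same[of b q r c d V "wm (b, c)"] cp bc bd pr bp wm[OF e] wm[OF f] w fl
          by (auto simp: d_def r_def)
      qed
    qed
    with bp show "b = p \<and> c = q" by simp
  qed
  then have "card S2 \<le> card (V \<times> (UNIV :: bool set))"
    using finV wm(1) by (intro card_inj_on_le) (auto simp: wedge_def)
  then have c2: "card S2 \<le> 2 * card V" by (simp add: card_cartesian_product)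
  have "S = S1 \<union> S2" by (auto simp: S1_def S2_def)
  then have "card S \<le> card S1 + card S2" by (metis card_Un_le)
  then show ?thesis using c1 c2 by simp
qed

section \<open>Crossings between two chains\<close>

lemma reach_exit:
  assumes "reach r c w" "P c" "\<not> P w"
  shows "\<exists>x y. (x = c \<or> reach r c x) \<and> P x \<and> step r x y \<and> \<not> P y \<and> (y = w \<or> reach r y w)"
  using assms unfolding reach_def
proof (induction rule: tranclp_induct)
  case (base y)
  then show ?case by blast
next
  case (step y z)
  show ?case
  proof (cases "P y")
    case True
    then show ?thesis using step by blast
  next
    case False
    then obtain x v where "x = c \<or> (step r)\<^sup>+\<^sup>+ c x" "P x" "step r x v" "\<not> P v"
      "v = y \<or> (step r)\<^sup>+\<^sup>+ v y" using step by blast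
    moreover from this have "(step r)\<^sup>+\<^sup>+ v z" using step(2) by (auto intro: tranclp.intros)
    ultimately show ?thesis by blast
  qed
qed

section \<open>Touching times and the chain of a lower curve\<close>

definition touch :: "'c \<Rightarrow> 'c \<Rightarrow> real" where
  "touch a b = (SOME s. s0 \<le> s \<and> s \<le> E a \<and> s \<le> E b \<and> F a s = F b s)"

text \<open>The condition \<open>E a \<le> E b\<close> keeps every listed curve alive as long as
  \<open>a\<close> is, so all of them can be compared with \<open>a\<close> and with each other
  until \<open>a\<close> ends.\<close>

definition nbrs :: "'c \<Rightarrow> 'c set" where
  "nbrs a = {b \<in> B. touches a b \<and> E a \<le> E b}"

lemma nbrsD:
  assumes "b \<in> nbrs a"
  shows "a \<in> A" "b \<in> B" "s0 \<le> touch a b" "touch a b \<le> E a" "E a \<le> E b"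
    "F a (touch a b) = F b (touch a b)" "a \<noteq> b"
    "\<And>s. s0 \<le> s \<Longrightarrow> s \<le> E a \<Longrightarrow> F a s \<le> F b s"
    "\<And>s. s0 \<le> s \<Longrightarrow> s \<le> E a \<Longrightarrow> s \<noteq> touch a b \<Longrightarrow> F a s < F b s"
proof -
  have t: "touches a b" and "b \<in> B" "E a \<le> E b" using assms by (auto simp: nbrs_def)
  show m: "a \<in> A" "b \<in> B" "E a \<le> E b" using assms touches_mem by (auto simp: nbrs_def)
  show ab: "a \<noteq> b" using m disj by auto
  from someI_ex[OF touches_eq[OF t]]
  show tt: "s0 \<le> touch a b" "touch a b \<le> E a" "F a (touch a b) = F b (touch a b)"
    by (auto simp: touch_def)
  show le: "F a s \<le> F b s" if "s0 \<le> s" "s \<le> E a" for s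
    using touches_le[OF t] that m by auto
  show "F a s < F b s" if "s0 \<le> s" "s \<le> E a" "s \<noteq> touch a b" for s
    using le[of s] once[of a b s "touch a b"] that tt m ab by force
qed

lemma touch_inj: "b \<in> nbrs a \<Longrightarrow> d \<in> nbrs a \<Longrightarrow> touch a b = touch a d \<Longrightarrow> b = d"
  using triple[of a b d "touch a b"] nbrsD(1-7)[of b a] nbrsD(1-7)[of d a] by fastforce

text \<open>This is the convexity of the chain. When \<open>a\<close> is on \<open>b\<close> it is
  strictly below \<open>d\<close>, and later the other way round, so \<open>b\<close> and
  \<open>d\<close> change order between the two touches. Touching times and crossing times thus
  alternate along the chain.\<close>

lemma touch_cross:
  assumes "b \<in> nbrs a" "d \<in> nbrs a" "touch a b < touch a d"
  shows "crossing_pair b d" "touch a b < cross_time b d" "cross_time b d < touch a d"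
proof -
  note B = nbrsD[OF assms(1)] and D = nbrsD[OF assms(2)]
  have 1: "F b (touch a b) < F d (touch a b)"
    using D(9)[of "touch a b"] B assms by auto
  have 2: "F d (touch a d) < F b (touch a d)"
    using B(9)[of "touch a d"] D assms by auto
  have "\<not> ini d b"
    using flip_ini[of d b "touch a b" "touch a d"] 1 2 B D assms by auto
  then have "ini b d" using ini_total[of b d] B D assms by auto
  then show c: "crossing_pair b d"
    using 2 B D by (auto simp: crossing_pair_def intro!: exI[of _ "touch a d"])
  note z = cross_time_props[OF c]
  show "touch a b < cross_time b d"
    using cross_after[OF c, of "touch a b"] 1 z B(3-5) D(3-5) assms(3)
    by (cases "touch a b = cross_time b d") force+
  show "cross_time b d < touch a d"
    using cross_before[OF c, of "touch a d"] 2 z B(3-5) D(3-5)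
    by (cases "touch a d = cross_time b d") force+
qed

lemma touch_ini:
  assumes "b \<in> nbrs a" "d \<in> nbrs a"
  shows "ini b d \<longleftrightarrow> touch a b < touch a d"
proof (cases "touch a b" "touch a d" rule: linorder_cases)
  case less
  then show ?thesis using touch_cross(1)[OF assms] by (simp add: crossing_pair_def)
next
  case equal
  then show ?thesis using touch_inj[OF assms] ini_neq by auto
next
  case greater
  then show ?thesis using touch_cross(1)[OF assms(2,1)] ini_asym by (auto simp: crossing_pair_def)
qed

definition consec :: "'c \<Rightarrow> 'c \<Rightarrow> 'c \<Rightarrow> bool" where
  "consec a b b' \<longleftrightarrow> b \<in> nbrs a \<and> b' \<in> nbrs a \<and> touch a b < touch a b' \<and>
     (\<forall>d\<in>nbrs a. \<not> (touch a b < touch a d \<and> touch a d < touch a b'))"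

lemma consecD:
  assumes "consec a b b'"
  shows "crossing_pair b b'" "a \<in> A" "b \<in> B" "b' \<in> B" "ini b b'"
    "s0 \<le> touch a b" "touch a b < cross_time b b'" "cross_time b b' < touch a b'"
    "touch a b' \<le> E a" "E a \<le> E b" "E a \<le> E b'" "F b (cross_time b b') = F b' (cross_time b b')"
    "F a (touch a b) = F b (touch a b)" "F a (touch a b') = F b' (touch a b')"
    "b \<in> nbrs a" "b' \<in> nbrs a"
proof -
  show n: "b \<in> nbrs a" "b' \<in> nbrs a" using assms by (auto simp: consec_def)
  have t: "touch a b < touch a b'" using assms by (auto simp: consec_def)
  note c = touch_cross[OF n t]
  show "crossing_pair b b'" "touch a b < cross_time b b'" "cross_time b b' < touch a b'" by fact+
  show "a \<in> A" "b \<in> B" "b' \<in> B" "s0 \<le> touch a b" "touch a b' \<le> E a" "E a \<le> E b" "E a \<le> E b'"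
    "F a (touch a b) = F b (touch a b)" "F a (touch a b') = F b' (touch a b')"
    using nbrsD[OF n(1)] nbrsD[OF n(2)] by auto
  show "ini b b'" "F b (cross_time b b') = F b' (cross_time b b')"
    using c(1) cross_time_props[OF c(1)] by (auto simp: crossing_pair_def)
qed

lemma consec_next: "consec a b b' \<Longrightarrow> d \<in> nbrs a \<Longrightarrow> touch a b < touch a d \<Longrightarrow> touch a b' \<le> touch a d"
  by (force simp: consec_def)

lemma consec_unique: "consec a b b' \<Longrightarrow> consec a b d' \<Longrightarrow> b' = d'"
  using touch_inj[of b' a d'] unfolding consec_def by force

text \<open>Initial order and touching order agree on a chain, so two different consecutive pairs of
  \<open>a\<close> do not overlap. Through \<open>c\<close> and \<open>g\<close>, \<open>b\<close>
  starts below \<open>d'\<close>, so the first pair precedes the second or equals it.\<close>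

lemma gap_order:
  assumes e: "consec a b b'" and e': "consec a d d'" and g: "ini b c" "c = g \<or> ini c g" "ini g d'"
  shows "(b = d \<and> b' = d') \<or> touch a b' \<le> touch a d"
proof -
  note eD = consecD[OF e] and e'D = consecD[OF e']
  have "ini b d'" using g ini_trans by blast
  then have "touch a b < touch a d'" using touch_ini eD(15) e'D(16) by simp
  then have "\<not> touch a d < touch a b" using consec_next[OF e' eD(15)] by auto
  then consider "touch a b < touch a d" | "b = d"
    using touch_inj[OF eD(15) e'D(15)] by fastforce
  then show ?thesis
    using consec_next[OF e e'D(15)] consec_unique[OF e, of d'] e' by cases auto
qed

text \<open>A conflict speaks about paths; this turns it into events in time. A curve
  \<open>x\<close> on the way from \<open>c\<close> meets a curve \<open>w\<close> at a time
  \<theta> between the slopes \<open>q\<close> and \<open>r\<close> of the two edges. There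
  \<open>w\<close> is \<open>b'\<close> or above it, and \<open>x\<close> is not above
  \<open>c'\<close>. From \<theta> until \<open>r\<close>, while \<open>b'\<close> lives,
  \<open>c\<close> or some curve reached from it is at or above \<open>b'\<close>.\<close>

lemma up_data:
  assumes e: "consec a b b'" and f: "consec p c c'" and uc: "up_conflict (b, b') (c, c')"
    and q: "q = cross_time b b'" and r: "r = cross_time c c'"
  obtains x w \<theta> where "q \<le> \<theta>" "\<theta> \<le> r" "x \<in> B" "w \<in> B" "\<theta> \<le> E x" "\<theta> \<le> E w" "F x \<theta> = F w \<theta>"
    "\<not> (w = b' \<and> w = c')"
    "x = c \<or> reach r c x" "ini x w" "w = b' \<or> ini w b'" "w = c' \<or> ini w c'"
    "\<And>s. \<lbrakk>q \<le> s; s \<le> E w; s \<le> E b'\<rbrakk> \<Longrightarrow> w = b' \<or> F b' s < F w s"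
    "F x \<theta> \<le> F c' \<theta>" "F c q < F b q" "ini b c" "ini c b'" "ini c c'"
    "\<And>u. \<lbrakk>\<theta> \<le> u; u \<le> r; u \<le> E b'\<rbrakk> \<Longrightarrow>
       \<exists>y. (y = c \<or> reach r c y) \<and> u \<le> E y \<and> (y = x \<or> ini y x) \<and> F b' u \<le> F y u"
proof -
  note eD = consecD[OF e] and fD = consecD[OF f]
  obtain w0 where w0: "w0 \<in> B" "ini b c" "ini c w0" "w0 = b' \<or> ini w0 b'" "w0 = c' \<or> ini w0 c'"
    "\<not> (w0 = b' \<and> w0 = c')" "reach q b c" "reach r c w0 \<or> w0 = c'" "\<not> reach q b w0"
    using uc by (auto simp: up_conflict_def q r)
  have "\<exists>x w \<theta> v. q \<le> \<theta> \<and> \<theta> \<le> r \<and> x \<in> B \<and> w \<in> B \<and> v \<le> E x \<and> v \<le> E w \<and> \<theta> \<le> v \<and> F x \<theta> = F w \<theta> \<and>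
     (x = c \<or> reach r c x) \<and> ini x w \<and> (w = w0 \<or> ini w w0) \<and> F w v < F x v \<and> \<not> reach q b w"
  proof (cases "reach r c w0")
    case True
    \<comment> \<open>The path from \<open>c\<close> to \<open>w0\<close> starts below the edge at
      \<open>b\<close> and leaves that region with the step from \<open>x\<close> to
      \<open>y\<close>. This step is available by time \<open>r\<close> but not by time
      \<open>q\<close>, so \<open>x\<close> and \<open>y\<close> meet in between.\<close>
    obtain x y where xy: "x = c \<or> reach r c x" "reach q b x" "step r x y" "\<not> reach q b y"
      "y = w0 \<or> reach r y w0"
      using reach_exit[OF True, of "reach q b"] w0 by blast
    obtain v where v: "s0 \<le> v" "v \<le> r" "v \<le> E x" "v \<le> E y" "F y v < F x v" "x \<in> B" "y \<in> B" "ini x y"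
      using xy by (auto simp: step_def)
    have ns: "\<not> step q x y" using xy reach_extend by blast
    then have qv: "q < v" using v stepI by (meson not_less)
    have s0q: "s0 \<le> q" using eD q by auto
    have "F x q \<le> F y q" using ns stepI[of x y q q] v qv s0q by force
    then obtain \<theta> where "q \<le> \<theta>" "\<theta> \<le> v" "F x \<theta> = F y \<theta>"
      using zero_between[of x y q v] v qv s0q by force
    then show ?thesis using v xy reach_ini by (intro exI[of _ x] exI[of _ y] exI[of _ \<theta>] exI[of _ v]) auto
  next
    case False
    then have wc: "w0 = c'" using w0 by simp
    \<comment> \<open>Here the witness is \<open>c'\<close> itself, and the meeting is the crossing
      of \<open>c\<close> and \<open>c'\<close> at \<open>r\<close>. The time at which
      \<open>c\<close> is strictly above \<open>c'\<close> is the touch of \<open>p\<close> with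
      \<open>c'\<close>, since \<open>p\<close> is strictly below \<open>c\<close> there.\<close>
    have "q \<le> r"
    proof (rule ccontr)
      assume "\<not> q \<le> r"
      then have "step q c c'" using cross_step[OF fD(1)] r by simp
      then show False using w0 wc reach_extend by blast
    qed
    then show ?thesis using fD wc w0 nbrsD(9)[OF fD(15), of "touch p c'"]
      by (intro exI[of _ c] exI[of _ c'] exI[of _ r] exI[of _ "touch p c'"]) (auto simp: r)
  qed
  then obtain x w \<theta> v where *: "q \<le> \<theta>" "\<theta> \<le> r" "x \<in> B" "w \<in> B" "v \<le> E x" "v \<le> E w" "\<theta> \<le> v"
    "F x \<theta> = F w \<theta>" "x = c \<or> reach r c x" "ini x w" "w = w0 \<or> ini w w0" "F w v < F x v"
    "\<not> reach q b w" by blast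
  have qs: "s0 \<le> q" using eD q by auto
  have qr: "q \<le> r" "r < E c" "r < E c'" "q < E b" "q < E b'" using * fD eD q r by auto
  have cq: "F c q < F b q" using reach_alive[OF w0(7)] qs qr by auto
  have xc: "x = c \<or> ini c x" using * reach_ini by blast
  have xw0: "ini x w0" using * ini_trans by blast
  have wb: "w = b' \<or> ini w b'" and wc: "w = c' \<or> ini w c'" using * w0 ini_trans by blast+
  have xb: "ini x b'" and xc': "ini x c'" using wb wc * ini_trans by blast+
  have bw: "ini b w" using w0 xc * ini_trans by blast
  \<comment> \<open>Not being below \<open>b\<close> at \<open>q\<close>, where \<open>b\<close> and
    \<open>b'\<close> cross, \<open>w\<close> is above \<open>b'\<close> there; having started below
    \<open>b'\<close>, it stays above.\<close>
  have L2q: "F b' q < F w q" if "w \<noteq> b'"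
  proof -
    have "\<not> F w q < F b q"
      using stepI[of b w q q] bw * eD qs qr reach_step[of q b w] by auto
    moreover have "F b q \<noteq> F w q"
      using triple[of b b' w q] that ini_neq[OF bw] ini_neq[OF eD(5)] eD(3,4,12) *(1,4,6,7) qs qr q
      by auto
    ultimately show ?thesis using eD q by auto
  qed
  have L2: "w = b' \<or> F b' s < F w s" if "q \<le> s" "s \<le> E w" "s \<le> E b'" for s
    using L2q flip_ini[of w b' q s] wb * eD that qs by auto
  have L3: "F x \<theta> \<le> F c' \<theta>"
  proof (rule ccontr)
    assume "\<not> ?thesis"
    then have "step r x c'" using * xc' fD qs qr by (intro stepI[of _ _ \<theta>]) auto
    then have "reach r c c'" using * reach_extend by blast
    then show False using not_reach_cross[OF fD(1), of r] r qs qr by auto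
  qed
  have G: "\<exists>y. (y = c \<or> reach r c y) \<and> u \<le> E y \<and> (y = x \<or> ini y x) \<and> F b' u \<le> F y u"
    if u: "\<theta> \<le> u" "u \<le> r" "u \<le> E b'" for u
  proof (cases "u = \<theta>")
    case True
    then show ?thesis using * L2[of \<theta>] u by (intro exI[of _ x]) auto
  next
    case False
    \<comment> \<open>A time at which \<open>b'\<close> is strictly below \<open>x\<close>. If
      \<open>w\<close> is \<open>b'\<close>, then \<open>x\<close> meets it at \<theta> and is
      strictly above only afterwards; otherwise \<open>b'\<close> is already strictly below the
      meeting of \<open>w\<close> and \<open>x\<close> at \<theta>.\<close>
    define v' where "v' = (if w = b' then min v u else \<theta>)"
    have "\<theta> \<noteq> v" using * by auto
    then have "F b' v' < F x v'"
      using L2[of \<theta>] after_zero[of x w \<theta> v' v] * u False qs by (auto simp: v'_def)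
    moreover have "s0 \<le> v'" "v' \<le> u" "v' \<le> E x" using * u qs by (auto simp: v'_def)
    ultimately have "\<exists>y. (y = c \<or> reach r c y) \<and> u \<le> E y \<and> (y = x \<or> ini y x) \<and> F b' u < F y u"
      using * u qr xb eD fD by (intro reach_dominate[of c x r b' v' u]) auto
    then show ?thesis by fastforce
  qed
  have nbc: "\<not> (w = b' \<and> w = c')" using *(11) w0(4-6) ini_asym by auto
  have cb: "ini c b'" using xc xb ini_trans by blast
  have \<theta>E: "\<theta> \<le> E x" "\<theta> \<le> E w" using * by auto
  show thesis
    by (rule that[of \<theta> x w]) (fact *(1-4) \<theta>E *(8) nbc *(9,10) wb wc L2 L3 cq w0(2) cb fD(5) G)+
qed

text \<open>The counterpart of \<open>up_data\<close> with the two edges in exchanged roles: the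
  path now starts from \<open>b\<close>, and the meeting of \<open>g\<close> and \<open>z\<close>
  takes place after \<open>r\<close> and not after \<open>q\<close>.\<close>

lemma down_data:
  assumes e: "consec a b b'" and f: "consec p c c'" and dc: "down_conflict (b, b') (c, c')"
    and q: "q = cross_time b b'" and r: "r = cross_time c c'"
  obtains g z \<tau> where "r < \<tau>" "\<tau> \<le> q" "g \<in> B" "z \<in> B" "\<tau> \<le> E g" "\<tau> \<le> E z" "F g \<tau> = F z \<tau>"
    "\<not> (z = b' \<and> z = c')" "g = b \<or> reach q b g" "ini g z" "z = b' \<or> reach q b z"
    "z = b' \<or> ini z b'" "z = c' \<or> ini z c'"
    "\<And>s. \<lbrakk>r \<le> s; s \<le> E z; s \<le> E c'\<rbrakk> \<Longrightarrow> z = c' \<or> F c' s < F z s"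
    "F g \<tau> \<le> F b' \<tau>" "\<not> reach q b c" "ini b c" "ini c b'" "ini c c'"
    "\<And>u. \<lbrakk>\<tau> \<le> u; u \<le> q; u \<le> E c'\<rbrakk> \<Longrightarrow>
       \<exists>y. (y = b \<or> reach q b y) \<and> u \<le> E y \<and> (y = g \<or> ini y g) \<and> F c' u \<le> F y u"
proof -
  note eD = consecD[OF e] and fD = consecD[OF f]
  obtain w where w: "w \<in> B" "ini b c" "ini c w" "w = b' \<or> ini w b'" "w = c' \<or> ini w c'"
    "\<not> (w = b' \<and> w = c')" "\<not> reach q b c" "reach q b w \<or> w = b'" "\<not> reach r c w"
    using dc by (auto simp: down_conflict_def q r)
  \<comment> \<open>The set that the path from \<open>b\<close> has to enter. The condition
    \<open>ini c x\<close> matters: a curve that starts below \<open>c\<close>, such as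
    \<open>b\<close>, is never reached from \<open>c\<close>, so without it the path would start
    inside the set.\<close>
  define Q where "Q = (\<lambda>x. ini c x \<and> \<not> reach r c x)"
  have qs: "s0 \<le> q" "s0 \<le> r" and qr: "r < E c" "r < E c'" "q < E b" "q < E b'" using eD fD q r by auto
  have Qb: "\<not> Q b" and Qw: "Q w" using w ini_asym by (auto simp: Q_def)
  have "\<exists>g z \<tau> v. \<tau> \<le> q \<and> s0 \<le> \<tau> \<and> g \<in> B \<and> z \<in> B \<and> v \<le> E g \<and> v \<le> E z \<and> \<tau> < v \<and> F g \<tau> = F z \<tau> \<and>
     (g = b \<or> reach q b g) \<and> ini g z \<and> (z = w \<or> ini z w) \<and> F z v < F g v \<and> \<not> Q g \<and> Q z \<and>
     (z = b' \<or> reach q b z)"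
  proof (cases "reach q b w")
    case True
    obtain g z where gz: "g = b \<or> reach q b g" "\<not> Q g" "step q g z" "Q z" "z = w \<or> reach q z w"
      using reach_exit[OF True, of "\<lambda>x. \<not> Q x"] Qb Qw by blast
    obtain v where v: "s0 \<le> v" "v \<le> q" "v \<le> E g" "v \<le> E z" "F z v < F g v" "g \<in> B" "z \<in> B" "ini g z"
      using gz by (auto simp: step_def)
    obtain \<tau> where t: "s0 \<le> \<tau>" "\<tau> \<le> v" "F g \<tau> = F z \<tau>"
      using zero_between[of g z s0 v] v by (force simp: ini_def)
    then have "\<tau> < v" using v by (cases "\<tau> = v") auto
    then show ?thesis using v t gz reach_ini reach_extend[OF gz(1,3)]
      by (intro exI[of _ g] exI[of _ z] exI[of _ \<tau>] exI[of _ v]) auto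
  next
    case False
    then have wb: "w = b'" using w by simp
    show ?thesis using eD wb w Qb Qw qs nbrsD(9)[OF eD(15), of "touch a b'"]
      by (intro exI[of _ b] exI[of _ b'] exI[of _ q] exI[of _ "touch a b'"]) (auto simp: q)
  qed
  then obtain g z \<tau> v where *: "\<tau> \<le> q" "s0 \<le> \<tau>" "g \<in> B" "z \<in> B" "v \<le> E g" "v \<le> E z" "\<tau> < v"
    "F g \<tau> = F z \<tau>" "g = b \<or> reach q b g" "ini g z" "z = w \<or> ini z w" "F z v < F g v"
    "\<not> Q g" "Q z" "z = b' \<or> reach q b z" by blast
  have zQ: "ini c z" "\<not> reach r c z" using * by (auto simp: Q_def)
  have nz: "\<not> F z s < F c s" if "s0 \<le> s" "s \<le> r" "s \<le> E z" for s
    using stepI[of c z s r] that qr fD(3) * zQ reach_step by auto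
  have zb: "z = b' \<or> ini z b'" and zc: "z = c' \<or> ini z c'" using * w ini_trans by blast+
  have gb: "ini g b'" and gc: "ini g c'" using zb zc * ini_trans by blast+
  \<comment> \<open>Up to time \<open>r\<close>, \<open>z\<close> is never below \<open>c\<close>.
    Suppose the meeting is not after \<open>r\<close>. If \<open>g\<close> is reached from
    \<open>c\<close>, it can meet \<open>z\<close> no earlier than \<open>r\<close>, and at
    \<open>r\<close> it is below \<open>c\<close>. Otherwise \<open>g\<close> starts below
    \<open>c\<close> and is still below it at \<tau>, since \<open>c\<close> is not reached from
    \<open>b\<close>. Either way \<open>z\<close> would be below \<open>c\<close>.\<close>
  have r\<tau>: "r < \<tau>"
  proof (rule ccontr)
    assume "\<not> r < \<tau>"
    then have tr: "\<tau> \<le> r" by simp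
    show False
    proof (cases "reach r c g")
      case True
      have ns: "\<not> step r g z" using True zQ reach_extend by blast
      have "\<not> v \<le> r" using ns stepI[of g z v r] * by auto
      then have "r \<le> E g" "r \<le> E z" "r < v" using * by auto
      have "\<tau> = r"
        using after_zero[of g z \<tau> r v] ns stepI[of g z r r] tr * qs \<open>r < v\<close> by force
      moreover have "F g r < F c r" using reach_alive[OF True] qs qr \<open>r \<le> E g\<close> by auto
      ultimately show False using nz[of r] * qs by auto
    next
      case False
      then have ncg: "\<not> ini c g" using * by (auto simp: Q_def)
      have "g \<noteq> c" using * w ini_neq by auto
      then have gc1: "ini g c" using ncg ini_total[of g c] * fD by auto
      have "\<not> step q g c" using * w reach_extend by blast
      then have "F g \<tau> \<le> F c \<tau>" using stepI[of g c \<tau> q] gc1 * fD tr qr by force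
      moreover have "F g \<tau> \<noteq> F c \<tau>"
        using triple[of g c z \<tau>] ini_neq[OF gc1] ini_neq[OF zQ(1)] ini_neq[OF *(10)] * fD(3) tr qr
        by auto
      ultimately show False using nz[of \<tau>] * tr by auto
    qed
  qed
  have U2r: "F c' r < F z r" if "z \<noteq> c'"
  proof -
    have "F c r \<noteq> F z r"
      using triple[of c c' z r] that ini_neq[OF zQ(1)] ini_neq[OF fD(5)] fD(3,4,12) * qs qr r\<tau> r by auto
    then show ?thesis using nz[of r] fD(12) r qs r\<tau> * by auto
  qed
  have U2: "z = c' \<or> F c' s < F z s" if "r \<le> s" "s \<le> E z" "s \<le> E c'" for s
    using U2r flip_ini[of z c' r s] zc * fD that qs by auto
  have U3: "F g \<tau> \<le> F b' \<tau>"
  proof (rule ccontr)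
    assume "\<not> ?thesis"
    then have "step q g b'" using * gb eD qs qr by (intro stepI[of _ _ \<tau>]) auto
    then have "reach q b b'" using * reach_extend by blast
    then show False using not_reach_cross[OF eD(1), of q] q qs qr by auto
  qed
  have G: "\<exists>y. (y = b \<or> reach q b y) \<and> u \<le> E y \<and> (y = g \<or> ini y g) \<and> F c' u \<le> F y u"
    if u: "\<tau> \<le> u" "u \<le> q" "u \<le> E c'" for u
  proof (cases "u = \<tau>")
    case True
    then show ?thesis using * U2[of \<tau>] r\<tau> u by (intro exI[of _ g]) auto
  next
    case False
    define v' where "v' = (if z = c' then min v u else \<tau>)"
    have "F c' v' < F g v'"
      using U2[of \<tau>] after_zero[of g z \<tau> v' v] * u False qs r\<tau> by (auto simp: v'_def)
    moreover have "s0 \<le> v'" "v' \<le> u" "v' \<le> E g" using * u qs by (auto simp: v'_def)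
    ultimately have "\<exists>y. (y = b \<or> reach q b y) \<and> u \<le> E y \<and> (y = g \<or> ini y g) \<and> F c' u < F y u"
      using * u qr gc eD fD by (intro reach_dominate[of b g q c' v' u]) auto
    then show ?thesis by fastforce
  qed
  have nbc: "\<not> (z = b' \<and> z = c')" using *(11) w(4-6) ini_asym by auto
  have cb: "ini c b'" using w ini_trans by blast
  have \<tau>E: "\<tau> \<le> E g" "\<tau> \<le> E z" using * by auto
  show thesis
    by (rule that[of \<tau> g z]) (fact r\<tau> *(1,3,4) \<tau>E *(8) nbc *(9,10,15) zb zc U2 U3 w(7) w(2) cb fD(5) G)+
qed

text \<open>With \<open>b' = c'\<close> the meeting of \<open>x\<close> and \<open>w\<close> would
  be above this curve by the bound on \<open>w\<close> and not above it by the bound on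
  \<open>x\<close>. Sampling needs the four curves of a conflict to be distinct.\<close>

lemma up_conflict_distinct:
  assumes e: "consec a b b'" and f: "consec p c c'" and uc: "up_conflict (b, b') (c, c')"
  shows "b' \<noteq> c'"
proof
  assume eq: "b' = c'"
  obtain x w \<theta> where d: "cross_time b b' \<le> \<theta>" "\<theta> \<le> cross_time c c'" "\<theta> \<le> E w" "F x \<theta> = F w \<theta>"
    "\<not> (w = b' \<and> w = c')" "F x \<theta> \<le> F c' \<theta>"
    "\<And>s. \<lbrakk>cross_time b b' \<le> s; s \<le> E w; s \<le> E b'\<rbrakk> \<Longrightarrow> w = b' \<or> F b' s < F w s"
    by (rule up_data[OF e f uc refl refl]) (rule that; assumption)
  have "\<theta> \<le> E b'" using d eq consecD(8,9,11)[OF f] by auto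
  then show False using d(1,3-6) d(7)[of \<theta>] eq by auto
qed

lemma down_conflict_distinct:
  assumes e: "consec a b b'" and f: "consec p c c'" and dc: "down_conflict (b, b') (c, c')"
  shows "b' \<noteq> c'"
proof
  assume eq: "b' = c'"
  obtain g z \<tau> where d: "cross_time c c' < \<tau>" "\<tau> \<le> cross_time b b'" "\<tau> \<le> E z" "F g \<tau> = F z \<tau>"
    "\<not> (z = b' \<and> z = c')" "F g \<tau> \<le> F b' \<tau>"
    "\<And>s. \<lbrakk>cross_time c c' \<le> s; s \<le> E z; s \<le> E c'\<rbrakk> \<Longrightarrow> z = c' \<or> F c' s < F z s"
    by (rule down_data[OF e f dc refl refl]) (rule that; assumption)
  have "\<tau> \<le> E c'" using d eq consecD(8,9,11)[OF e] by auto
  then show False using d(1,3-6) d(7)[of \<tau>] eq by auto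
qed

text \<open>Conflicts of this kind occur in the same order along both chains, and the touch
  belonging to the earlier one on \<open>p\<close> precedes the crossing belonging to the later one
  on \<open>a\<close>. The reason: at \<open>q2\<close>, \<open>g\<close> is below \<open>d\<close>,
  which is not above \<open>b'\<close>, while \<open>c\<close> or \<open>c'\<close> is at or above
  \<open>b'\<close>. So \<open>g\<close> has already fallen below a curve that \<open>p\<close>
  touches earlier.\<close>

lemma up_pair:
  assumes e: "consec a b b'" and f: "consec p c c'" and uc: "up_conflict (b, b') (c, c')"
    and e2: "consec a d d'" and f2: "consec p g g'" and uc2: "up_conflict (d, d') (g, g')"
    and lt: "touch p c < touch p g"
  shows "touch a b' \<le> touch a d \<and> touch p c < cross_time d d'"
proof -
  define q r q2 r2 where qr: "q = cross_time b b'" "r = cross_time c c'" "q2 = cross_time d d'" "r2 = cross_time g g'"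
  note eD = consecD[OF e] and fD = consecD[OF f] and e2D = consecD[OF e2] and f2D = consecD[OF f2]
  obtain x w \<theta> where d1: "q \<le> \<theta>" "\<theta> \<le> r" "x \<in> B" "w \<in> B" "\<theta> \<le> E x" "\<theta> \<le> E w" "F x \<theta> = F w \<theta>"
    "x = c \<or> reach r c x" "ini x w" "w = b' \<or> ini w b'" "w = c' \<or> ini w c'"
    "\<And>s. \<lbrakk>q \<le> s; s \<le> E w; s \<le> E b'\<rbrakk> \<Longrightarrow> w = b' \<or> F b' s < F w s"
    "F x \<theta> \<le> F c' \<theta>" "F c q < F b q" "ini b c" "ini c b'" "ini c c'"
    "\<And>u. \<lbrakk>\<theta> \<le> u; u \<le> r; u \<le> E b'\<rbrakk> \<Longrightarrow>
       \<exists>y. (y = c \<or> reach r c y) \<and> u \<le> E y \<and> (y = x \<or> ini y x) \<and> F b' u \<le> F y u"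
    by (rule up_data[OF e f uc qr(1,2)]) (rule that; assumption)
  obtain \<theta>2 where d2: "q2 \<le> \<theta>2" "\<theta>2 \<le> r2" "F g q2 < F d q2" "ini d g" "ini g d'"
    by (rule up_data[OF e2 f2 uc2 qr(3,4)]) (rule that; assumption)
  note bc' = up_conflict_distinct[OF e f uc]
  have cg: "ini c g" using touch_ini[OF fD(15) f2D(15)] lt by simp
  have tc': "touch p c' \<le> touch p g" using consec_next[OF f f2D(15) lt] .
  have c'g: "c' = g \<or> touch p c' < touch p g"
    using tc' touch_inj[OF fD(16) f2D(15)] by fastforce
  then have c'g': "c' = g \<or> ini c' g" using touch_ini[OF fD(16) f2D(15)] by simp
  have s0q: "s0 \<le> q" "s0 \<le> q2" using eD e2D qr by auto
  \<comment> \<open>Once above \<open>c'\<close>, \<open>w\<close> would remain so until \<theta>,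
    where it meets \<open>x\<close>, which is not above \<open>c'\<close>.\<close>
  have contra: False if "q \<le> s" "s \<le> \<theta>" "F c' s < F b' s \<or> F c' s < F w s" "s \<le> E b'" for s
  proof -
    have "s \<le> E w" using that d1 by auto
    then have "F c' s < F w s" using d1(12)[of s] that by auto
    moreover have "ini w c'" using d1(11) calculation by auto
    ultimately have "F c' \<theta> < F w \<theta>"
      using flip_ini[of w c' s \<theta>] d1(1-6) that fD qr s0q by auto
    then show False using d1 by simp
  qed
  \<comment> \<open>As long as \<open>p\<close> has still to touch \<open>h\<close>, the later curve
    \<open>g\<close> cannot be below \<open>h\<close>: it would remain below until the touch, and
    there be below \<open>p\<close>.\<close>
  have L: "touch p h < s" if "h \<in> nbrs p" "ini h g" "F g s < F h s" "s0 \<le> s" for h s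
  proof (rule ccontr)
    assume n: "\<not> touch p h < s"
    note hD = nbrsD[OF that(1)] and gD = nbrsD[OF f2D(15)]
    have "F g (touch p h) < F h (touch p h)"
      using flip_ini[of h g s "touch p h"] that hD gD n by auto
    then show False using gD(8)[of "touch p h"] hD by auto
  qed
  consider (same) "b = d" "b' = d'" | (diff) "touch a b' \<le> touch a d"
    using gap_order[OF e e2 d1(15) disjI2[OF cg] d2(5)] by blast
  then show ?thesis
  proof cases
    case same
    have bq: "F g q < F b q" using d2 same qr by simp
    have "ini c' b'" using c'g' d2(5) same ini_trans by blast
    have "ini b c'" using d1 ini_trans by blast
    have "F c' q \<noteq> F b q"
      using triple[of b b' c' q] ini_neq[OF \<open>ini b c'\<close>] bc' ini_neq[OF eD(5)] eD(3,4,12) fD(4) s0q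
        eD(7-11) fD(7-11) d1(1,2) qr by auto
    moreover have "\<not> F c' q < F b q"
    proof
      assume l: "F c' q < F b q"
      then show False using contra[of q] d1(1) eD(7-12) qr by auto
    qed
    ultimately have "F g q < F c' q" using bq by auto
    then have "c' \<noteq> g" "ini c' g" using c'g' by auto
    then have "touch p c' < q" using L[OF fD(16)] \<open>F g q < F c' q\<close> s0q by auto
    then show ?thesis using d1(1,2) fD qr by auto
  next
    case diff
    have qq2: "q < q2" "q2 \<le> r2" using diff eD e2D d2 qr by auto
    have al: "q2 \<le> E c" "q2 \<le> E c'" "q2 \<le> E b'" "q2 \<le> E g" "q2 \<le> E p" "q2 \<le> E a"
      using qq2 f2D fD e2D eD qr by auto
    \<comment> \<open>Before \<theta> this is \<open>contra\<close>. From \<theta> on, some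
      \<open>y\<close> equal to \<open>c\<close> or reached from it is at or above
      \<open>b'\<close>. If \<open>r\<close> has passed, \<open>c\<close> dominates \<open>y\<close>
      at \<open>r\<close> and stays above \<open>b'\<close>; before \<open>r\<close>, a low
      \<open>c'\<close> would be reached from \<open>c\<close> too early, through
      \<open>y\<close>.\<close>
    have "\<not> (F c q2 < F b' q2 \<and> F c' q2 < F b' q2)"
    proof
      assume h: "F c q2 < F b' q2 \<and> F c' q2 < F b' q2"
      show False
      proof (cases "q2 < \<theta>")
        case True
        then show False using contra[of q2] h qq2 al by auto
      next
        case False
        define u where "u = min q2 r"
        obtain y where y: "y = c \<or> reach r c y" "u \<le> E y" "y = x \<or> ini y x" "F b' u \<le> F y u"
          using d1(18)[of u] False d1(2) al(3) by (auto simp: u_def min_le_iff_disj)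
        show False
        proof (cases "r \<le> q2")
          case True
          then have u: "u = r" by (simp add: u_def)
          have "F y r \<le> F c r" using y(1) reach_alive[of r c y] y(2) u fD qr by auto
          then have "F b' r \<le> F c r" using y u by simp
          moreover have "F b' r \<noteq> F c r"
            using triple[of c c' b' r] ini_neq[OF fD(5)] bc' ini_neq[OF d1(16)] fD(3,4,6-12) eD(4) al True qr
            by auto
          ultimately have "F b' r < F c r" by simp
          then have "F b' q2 < F c q2"
            using flip_ini[of c b' r q2] d1(16) fD eD al True qr by auto
          then show False using h by simp
        next
          case False
          then have u: "u = q2" by (simp add: u_def)
          have "y \<noteq> c" using y u h by auto
          then have yr: "reach r c y" using y by simp
          have "ini y c'" using y(3) d1(9,11) ini_trans by blast
          then have "step r y c'"
            using stepI[of y c' q2 r] reach_mem[OF yr] fD(4) s0q False al y u h by auto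
          then have "reach r c c'" using reach_extend y by blast
          then show False using not_reach_cross[OF fD(1), of r] qr fD by auto
        qed
      qed
    qed
    then have 1: "F b' q2 \<le> F c q2 \<or> F b' q2 \<le> F c' q2" by auto
    have "F d q2 \<le> F b' q2"
    proof (cases "b' = d")
      case False
      then have "touch a b' < touch a d" using diff touch_inj[OF eD(16) e2D(15)] by fastforce
      note tc = touch_cross[OF eD(16) e2D(15) this]
      show ?thesis using cross_after[OF tc(1), of q2] tc e2D al qr by auto
    qed simp
    then have "F g q2 < F c q2 \<or> F g q2 < F c' q2" using 1 d2 by auto
    then have "touch p c < q2"
    proof
      assume "F g q2 < F c q2"
      then show ?thesis using L[OF fD(15) cg] s0q by auto
    next
      assume h: "F g q2 < F c' q2"
      then have "ini c' g" using c'g' by auto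
      then show ?thesis using L[OF fD(16) _ h] s0q fD qr by auto
    qed
    then show ?thesis using diff qr by simp
  qed
qed

text \<open>As in \<open>up_pair\<close>, but the comparison is made at the slope \<open>r2\<close>
  of the later edge of \<open>p\<close>: there \<open>b\<close> or \<open>b'\<close> is at or above
  \<open>c'\<close>, hence above \<open>d\<close>, so \<open>a\<close> has already touched
  it.\<close>

lemma down_pair:
  assumes e: "consec a b b'" and f: "consec p c c'" and dc: "down_conflict (b, b') (c, c')"
    and e2: "consec a d d'" and f2: "consec p g g'" and dc2: "down_conflict (d, d') (g, g')"
    and lt: "touch p c < touch p g"
  shows "touch a b' \<le> touch a d \<and> touch a b < cross_time g g'"
proof -
  define q r q2 r2 where qr: "q = cross_time b b'" "r = cross_time c c'" "q2 = cross_time d d'" "r2 = cross_time g g'"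
  note eD = consecD[OF e] and fD = consecD[OF f] and e2D = consecD[OF e2] and f2D = consecD[OF f2]
  obtain x z \<tau> where d1: "r < \<tau>" "\<tau> \<le> q" "x \<in> B" "z \<in> B" "\<tau> \<le> E x" "\<tau> \<le> E z" "F x \<tau> = F z \<tau>"
    "\<not> (z = b' \<and> z = c')" "x = b \<or> reach q b x" "ini x z" "z = b' \<or> reach q b z"
    "z = b' \<or> ini z b'" "z = c' \<or> ini z c'"
    "\<And>s. \<lbrakk>r \<le> s; s \<le> E z; s \<le> E c'\<rbrakk> \<Longrightarrow> z = c' \<or> F c' s < F z s"
    "F x \<tau> \<le> F b' \<tau>" "\<not> reach q b c" "ini b c" "ini c b'" "ini c c'"
    "\<And>u. \<lbrakk>\<tau> \<le> u; u \<le> q; u \<le> E c'\<rbrakk> \<Longrightarrow>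
       \<exists>y. (y = b \<or> reach q b y) \<and> u \<le> E y \<and> (y = x \<or> ini y x) \<and> F c' u \<le> F y u"
    by (rule down_data[OF e f dc qr(1,2)]) (rule that; assumption)
  obtain \<tau>2 where d2: "r2 < \<tau>2" "\<tau>2 \<le> q2" "\<not> reach q2 d g" "ini d g" "ini g d'"
    by (rule down_data[OF e2 f2 dc2 qr(3,4)]) (rule that; assumption)
  note bc' = down_conflict_distinct[OF e f dc]
  have cg: "ini c g" using touch_ini[OF fD(15) f2D(15)] lt by simp
  have tc': "touch p c' \<le> touch p g" using consec_next[OF f f2D(15) lt] .
  have c'g: "c' = g \<or> touch p c' < touch p g"
    using tc' touch_inj[OF fD(16) f2D(15)] by fastforce
  then have c'g': "c' = g \<or> ini c' g" using touch_ini[OF fD(16) f2D(15)] by simp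
  have rr: "s0 \<le> r" "s0 \<le> r2" "r < r2" "r2 < q2" using fD f2D tc' d2 qr by auto
  have al: "r2 \<le> E c" "r2 \<le> E c'" "r2 \<le> E g" "r2 \<le> E g'" "r2 \<le> E d" "r2 \<le> E b" "r2 \<le> E b'" "r2 \<le> E a"
    using rr f2D fD e2D eD qr by auto
  have bc'i: "ini b c'" using d1 ini_trans by blast
  have gg: "F g r2 \<le> F c' r2" "c' \<noteq> g \<Longrightarrow> F g r2 < F c' r2"
  proof -
    show l: "F g r2 < F c' r2" if "c' \<noteq> g"
    proof -
      have "touch p c' < touch p g" using c'g that by simp
      note tc = touch_cross[OF fD(16) f2D(15) this]
      show ?thesis using cross_after[OF tc(1), of r2] tc f2D al qr by auto
    qed
    then show "F g r2 \<le> F c' r2" by fastforce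
  qed
  have dg: "F d r2 < F g r2"
  proof -
    have "\<not> F g r2 < F d r2"
      using stepI[of d g r2 q2] e2D f2D d2(3,4) rr al reach_step by auto
    moreover have "F d r2 \<noteq> F g r2"
      using triple[of g g' d r2] ini_neq[OF d2(4)] ini_neq[OF f2D(5)] ini_neq[OF ini_trans[OF d2(4) f2D(5)]]
        f2D(3,4,12) e2D(3) rr al qr by auto
    ultimately show ?thesis by auto
  qed
  have "\<not> (F b r2 < F c' r2 \<and> F b' r2 < F c' r2)"
  proof
    assume h: "F b r2 < F c' r2 \<and> F b' r2 < F c' r2"
    show False
    proof (cases "r2 < \<tau>")
      case True
      then have "F b' r2 < F z r2" using d1(14)[of r2] d1(6) rr al h by auto
      moreover have "ini z b'" using d1(12) calculation by auto
      ultimately have "F b' \<tau> < F z \<tau>"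
        using flip_ini[of z b' r2 \<tau>] True d1(2,4,6) eD qr rr by auto
      then show False using d1 by simp
    next
      case False
      define u where "u = min r2 q"
      obtain y where y: "y = b \<or> reach q b y" "u \<le> E y" "y = x \<or> ini y x" "F c' u \<le> F y u"
        using d1(20)[of u] False d1(2) al(2) by (auto simp: u_def min_le_iff_disj)
      show False
      proof (cases "q \<le> r2")
        case True
        then have u: "u = q" by (simp add: u_def)
        have "F y q \<le> F b q" using y(1) reach_alive[of q b y] y(2) u eD qr by auto
        then have "F c' q \<le> F b q" using y u by simp
        moreover have "F c' q \<noteq> F b q"
          using triple[of b b' c' q] ini_neq[OF eD(5)] bc' ini_neq[OF bc'i] eD(3,4,6-12) fD(4) al True qr
          by auto
        ultimately have "F c' q < F b q" by simp
        then have "F c' r2 < F b r2"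
          using flip_ini[of b c' q r2] bc'i fD eD al True qr by auto
        then show False using h by simp
      next
        case False
        then have u: "u = r2" by (simp add: u_def)
        have "y \<noteq> b" using y u h by auto
        then have yr: "reach q b y" using y by simp
        have "ini y b'" using y(3) d1(10,12) ini_trans by blast
        then have "step q y b'"
          using stepI[of y b' r2 q] reach_mem[OF yr] eD(4) rr False al y u h by auto
        then have "reach q b b'" using reach_extend y by blast
        then show False using not_reach_cross[OF eD(1), of q] qr eD by auto
      qed
    qed
  qed
  then have alt: "F d r2 < F b r2 \<or> F d r2 < F b' r2" using gg(1) dg by auto
  have L: "touch a h < r2" if "h \<in> nbrs a" "ini h d" "F d r2 < F h r2" for h
  proof (rule ccontr)
    assume n: "\<not> touch a h < r2"
    note hD = nbrsD[OF that(1)] and dD = nbrsD[OF e2D(15)]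
    have "F d (touch a h) < F h (touch a h)"
      using flip_ini[of h d r2 "touch a h"] that hD dD rr n by auto
    then show False using dD(8)[of "touch a h"] hD by auto
  qed
  consider (same) "b = d" "b' = d'" | (diff) "touch a b' \<le> touch a d"
    using gap_order[OF e e2 d1(17) disjI2[OF cg] d2(5)] by blast
  then show ?thesis
  proof cases
    case same
    have c'b': "ini c' b'" using c'g' d2(5) same ini_trans by blast
    have "z \<noteq> b'" using d1(13) c'b' ini_asym ini_neq by blast
    then have z: "reach q b z" using d1 by simp
    \<comment> \<open>If both conflicts use the same edge of \<open>a\<close>, then
      \<open>c'\<close> and hence \<open>g\<close> are reached from \<open>b\<close>, against the
      second conflict.\<close>
    have "reach q b c'"
    proof (cases "z = c'")
      case False
      then have "F c' r < F z r" using d1(14)[of r] d1(1,6) fD qr by auto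
      then have "step q z c'"
        using stepI[of z c' r q] False d1(13) d1(1-6) fD qr rr by auto
      then show ?thesis using z reach_extend by blast
    qed (use z in simp)
    moreover have "step q c' g" if "c' \<noteq> g"
      using stepI[of c' g r2 q] gg(2)[OF that] c'g' that fD(4) f2D(3) al rr same qr by auto
    ultimately have "reach q b g" using reach_extend by blast
    then show ?thesis using d2 same qr by simp
  next
    case diff
    have lt1: "touch a b < touch a b'" using eD by auto
    from alt have "touch a b < r2"
    proof
      assume "F d r2 < F b r2"
      moreover have "ini b d" using touch_ini[OF eD(15) e2D(15)] diff lt1 by simp
      ultimately show ?thesis using L[OF eD(15)] by auto
    next
      assume h: "F d r2 < F b' r2"
      then have "b' \<noteq> d" by auto
      then have "touch a b' < touch a d" using diff touch_inj[OF eD(16) e2D(15)] by fastforce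
      then have "ini b' d" using touch_ini[OF eD(16) e2D(15)] by simp
      then show ?thesis using L[OF eD(16) _ h] lt1 by auto
    qed
    then show ?thesis using diff qr by simp
  qed
qed

text \<open>If \<open>a\<close> is above \<open>p\<close> when \<open>p\<close> touches
  \<open>c\<close>, it stays above \<open>c\<close> while alive; but at \<open>r\<close>,
  \<open>c\<close> is at or above \<open>b'\<close> and so not below \<open>a\<close>, hence
  \<open>a\<close> has ended by then. If \<open>a\<close> is below \<open>p\<close> at that touch,
  then \<open>p\<close> must be below \<open>a\<close> when \<open>a\<close> touches
  \<open>b\<close>: otherwise \<open>p\<close> would be above \<open>b\<close> at \<open>q\<close>,
  although \<open>c\<close>, which \<open>p\<close> never passes, is below \<open>b\<close>
  there.\<close>

lemma up_single:
  assumes e: "consec a b b'" and f: "consec p c c'" and uc: "up_conflict (b, b') (c, c')" and ap: "a \<noteq> p"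
  shows "cross_time b b' \<le> cross_time c c'"
    "touch p c \<le> E a \<Longrightarrow> F p (touch p c) < F a (touch p c) \<Longrightarrow> E a < cross_time c c'"
    "touch p c \<le> E a \<Longrightarrow> \<not> F p (touch p c) < F a (touch p c) \<Longrightarrow>
       F a (touch p c) < F p (touch p c) \<and> F p (touch a b) < F a (touch a b)"
proof -
  define q r where qr: "q = cross_time b b'" "r = cross_time c c'"
  note eD = consecD[OF e] and fD = consecD[OF f]
  obtain x \<theta> where d1: "q \<le> \<theta>" "\<theta> \<le> r" "F c q < F b q"
    "\<And>u. \<lbrakk>\<theta> \<le> u; u \<le> r; u \<le> E b'\<rbrakk> \<Longrightarrow>
       \<exists>y. (y = c \<or> reach r c y) \<and> u \<le> E y \<and> (y = x \<or> ini y x) \<and> F b' u \<le> F y u"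
    by (rule up_data[OF e f uc qr]) (rule that; assumption)
  show qler: "cross_time b b' \<le> cross_time c c'" using d1 qr by simp
  note ba = nbrsD[OF eD(15)] nbrsD[OF eD(16)] and cp = nbrsD[OF fD(15)]
  have ac: "ini a c" "ini p b" using AB eD fD by (auto simp: ini_def)
  have ne: "a \<noteq> c" "p \<noteq> b" "p \<noteq> c" "a \<noteq> b" using ac ini_neq eD(2,3) fD(2,3) disj by auto
  show "E a < cross_time c c'" if u: "touch p c \<le> E a" "F p (touch p c) < F a (touch p c)"
  proof (rule ccontr)
    assume "\<not> ?thesis"
    then have ra: "r \<le> E a" using qr by simp
    then obtain y where y: "y = c \<or> reach r c y" "r \<le> E y" "F b' r \<le> F y r"
      using d1(4)[of r] d1(2) eD(11) by auto
    have "F y r \<le> F c r" using y(1) reach_alive[of r c y] y(2) fD qr by auto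
    moreover have "F a r \<le> F b' r" using nbrsD(8)[OF eD(16), of r] ra fD(6,7) qr by auto
    moreover have "F c r < F a r"
      using flip_ini[of a c "touch p c" r] ac u ra eD(2) fD qr by auto
    ultimately show False using y by simp
  qed
  show "F a (touch p c) < F p (touch p c) \<and> F p (touch a b) < F a (touch a b)"
    if u: "touch p c \<le> E a" "\<not> F p (touch p c) < F a (touch p c)"
  proof
    have "F a (touch p c) \<noteq> F p (touch p c)"
      using triple[of a p c "touch p c"] ne ap eD(2) fD u(1) by auto
    then show "F a (touch p c) < F p (touch p c)" using u by simp
    have tp: "touch a b \<le> E p" "q \<le> E p" using eD fD d1 qr by auto
    have "F p (touch a b) \<noteq> F a (touch a b)"
      using triple[of a p b "touch a b"] ne ap eD fD(2) tp by auto
    moreover have "\<not> F a (touch a b) < F p (touch a b)"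
    proof
      assume "F a (touch a b) < F p (touch a b)"
      then have "F b q < F p q"
        using flip_ini[of p b "touch a b" q] ac eD fD(2) tp qr by auto
      moreover have "F p q \<le> F c q" using cp(8)[of q] tp eD qr by auto
      ultimately show False using d1 by simp
    qed
    ultimately show "F p (touch a b) < F a (touch a b)" by simp
  qed
qed

text \<open>Two curves change sides at most once, so their relative positions at these times determine a
  conflict between their chains; hence there are at most 16 of each kind.\<close>
definition up_class :: "'c \<Rightarrow> 'c \<Rightarrow> ('c \<times> 'c) \<times> ('c \<times> 'c) \<Rightarrow> bool \<times> bool \<times> bool \<times> bool" where
  "up_class a p = (\<lambda>((b, b'), (c, c')). (E a < touch p c, F p (touch p c) < F a (touch p c),
     touch p c < touch a b, F a (cross_time b b') < F p (cross_time b b')))"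

text \<open>The first two bits being equal forces \<open>a\<close> to be below \<open>p\<close> at
  \<open>u\<close> and \<open>u2\<close> and above \<open>p\<close> at \<open>t\<close> and
  \<open>t2\<close>. In every interleaving of these times with \<open>q\<close> and
  \<open>q2\<close> that the other bits allow, three of the times contradict
  \<open>flip\<close>.\<close>

lemma up_class_less:
  assumes e: "consec a b b'" and f: "consec p c c'" and uc: "up_conflict (b, b') (c, c')"
    and e2: "consec a d d'" and f2: "consec p g g'" and uc2: "up_conflict (d, d') (g, g')"
    and lt: "touch p c < touch p g" and ap: "a \<noteq> p"
    and cl: "up_class a p ((b, b'), (c, c')) = up_class a p ((d, d'), (g, g'))"
  shows False
proof -
  define q r q2 r2 where qr: "q = cross_time b b'" "r = cross_time c c'" "q2 = cross_time d d'" "r2 = cross_time g g'"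
  define t t2 u u2 where tu: "t = touch a b" "t2 = touch a d" "u = touch p c" "u2 = touch p g"
  note eD = consecD[OF e] and fD = consecD[OF f] and e2D = consecD[OF e2] and f2D = consecD[OF f2]
  note s1 = up_single[OF e f uc ap, folded qr tu] and s2 = up_single[OF e2 f2 uc2 ap, folded qr tu]
  have cl': "E a < u \<longleftrightarrow> E a < u2" "F p u < F a u \<longleftrightarrow> F p u2 < F a u2" "u < t \<longleftrightarrow> u2 < t2"
    "F a q < F p q \<longleftrightarrow> F a q2 < F p q2"
    using cl by (auto simp: up_class_def qr tu)
  have o: "s0 \<le> t" "s0 \<le> u" "t < q" "q < t2" "t2 < q2" "q2 \<le> E a" "u < r" "r < u2" "u2 < r2" "r2 \<le> E p"
    "u < q2" "q \<le> r" "q2 \<le> r2"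
    using up_pair[OF e f uc e2 f2 uc2 lt] eD fD e2D f2D consec_next[OF f f2D(15) lt] s1(1) s2(1)
    by (auto simp: qr tu)
  have ap': "a \<in> A \<union> B" "p \<in> A \<union> B" "p \<noteq> a" using eD fD ap by auto
  have nA: "u \<le> E a" "u2 \<le> E a" using o cl' by auto
  have nB: "\<not> F p u < F a u" "\<not> F p u2 < F a u2" using s1(2) cl' nA o by auto
  have c: "F a u < F p u" "F p t < F a t" "F a u2 < F p u2" "F p t2 < F a t2"
    using s1(3) s2(3) nA nB by auto
  show False
  proof (cases "u < t")
    case True
    then show False using flip[of a p u t u2] c o ap' nA by auto
  next
    case False
    then have tu': "t \<le> u" "t2 \<le> u2" using cl' by auto
    show False
    proof (cases "F a q < F p q")
      case True
      then show False using flip[of p a t q t2] c o ap' nA by auto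
    next
      case nq: False
      show False
      proof (cases "u \<le> t2")
        case True
        then show False using flip[of a p u t2 u2] c o ap' nA tu' by auto
      next
        case False
        then show False using flip[of p a t2 u q2] c o ap' nA tu' nq cl' by auto
      qed
    qed
  qed
qed

text \<open>The edge of \<open>p\<close> is determined within a class by
  \<open>up_class_less\<close>. The edge of \<open>a\<close> is then determined too, since two
  different consecutive pairs of \<open>a\<close> cannot both enclose \<open>c\<close> in the
  initial order.\<close>

lemma up_class_inj:
  assumes "a \<noteq> p"
  shows "inj_on (up_class a p) {((b, b'), (c, c')). consec a b b' \<and> consec p c c' \<and> up_conflict (b, b') (c, c')}"
proof (rule inj_onI)
  fix y z
  assume "y \<in> {((b, b'), (c, c')). consec a b b' \<and> consec p c c' \<and> up_conflict (b, b') (c, c')}"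
    and "z \<in> {((b, b'), (c, c')). consec a b b' \<and> consec p c c' \<and> up_conflict (b, b') (c, c')}"
    and yz: "up_class a p y = up_class a p z"
  then obtain b b' c c' d d' g g' where y: "y = ((b, b'), (c, c'))" and z: "z = ((d, d'), (g, g'))"
    and e: "consec a b b'" and f: "consec p c c'" and uc: "up_conflict (b, b') (c, c')"
    and e2: "consec a d d'" and f2: "consec p g g'" and uc2: "up_conflict (d, d') (g, g')"
    by auto
  have cl: "up_class a p ((b, b'), (c, c')) = up_class a p ((d, d'), (g, g'))"
    using yz y z by simp
  have "touch p c = touch p g"
    using up_class_less[OF e f uc e2 f2 uc2 _ assms cl]
      up_class_less[OF e2 f2 uc2 e f uc _ assms cl[symmetric]] by (meson linorder_less_linear)
  then have cg: "c = g" using touch_inj consecD(15) f f2 by blast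
  then have c'g': "c' = g'" using consec_unique f f2 by blast
  have i: "ini b c" "ini c b'" "ini d g" "ini g d'"
    using uc uc2 ini_trans by (auto simp: up_conflict_def)
  have "\<not> touch a b' \<le> touch a d"
  proof
    assume "touch a b' \<le> touch a d"
    then have "b' = d \<or> ini b' d"
      using touch_inj touch_ini consecD(15)[OF e2] consecD(16)[OF e] by fastforce
    then show False using i cg ini_trans ini_asym by blast
  qed
  then show "y = z"
    using gap_order[OF e e2, of c g] i cg c'g' y z by auto
qed

text \<open>The reasoning of \<open>up_single\<close> with \<open>a\<close> and \<open>p\<close>
  exchanged. Its last step uses that \<open>c\<close> is not reached from \<open>b\<close> by time
  \<open>q\<close>, so \<open>c\<close> cannot be below \<open>b\<close> at
  \<open>r\<close>.\<close>

lemma down_single: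
  assumes e: "consec a b b'" and f: "consec p c c'" and dc: "down_conflict (b, b') (c, c')" and ap: "a \<noteq> p"
  shows "cross_time c c' < cross_time b b'"
    "touch a b \<le> E p \<Longrightarrow> F a (touch a b) < F p (touch a b) \<Longrightarrow> E p < cross_time b b'"
    "touch a b \<le> E p \<Longrightarrow> \<not> F a (touch a b) < F p (touch a b) \<Longrightarrow>
       F p (touch a b) < F a (touch a b) \<and> F a (touch p c) < F p (touch p c)"
proof -
  define q r where qr: "q = cross_time b b'" "r = cross_time c c'"
  note eD = consecD[OF e] and fD = consecD[OF f]
  obtain x \<tau> where d1: "r < \<tau>" "\<tau> \<le> q" "\<not> reach q b c" "ini b c"
    "\<And>u. \<lbrakk>\<tau> \<le> u; u \<le> q; u \<le> E c'\<rbrakk> \<Longrightarrow>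
       \<exists>y. (y = b \<or> reach q b y) \<and> u \<le> E y \<and> (y = x \<or> ini y x) \<and> F c' u \<le> F y u"
    by (rule down_data[OF e f dc qr]) (rule that; assumption)
  show rq: "cross_time c c' < cross_time b b'" using d1 qr by simp
  note ba = nbrsD[OF eD(15)] and cp = nbrsD[OF fD(15)] nbrsD[OF fD(16)]
  have ac: "ini a c" "ini p b" using AB eD fD by (auto simp: ini_def)
  have ne: "a \<noteq> c" "p \<noteq> b" "p \<noteq> c" "a \<noteq> b" using ac ini_neq eD(2,3) fD(2,3) disj by auto
  show "E p < cross_time b b'" if u: "touch a b \<le> E p" "F a (touch a b) < F p (touch a b)"
  proof (rule ccontr)
    assume "\<not> ?thesis"
    then have ra: "q \<le> E p" using qr by simp
    then obtain y where y: "y = b \<or> reach q b y" "q \<le> E y" "F c' q \<le> F y q"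
      using d1(5)[of q] d1(2) fD(11) by auto
    have "F y q \<le> F b q" using y(1) reach_alive[of q b y] y(2) eD qr by auto
    moreover have "F p q \<le> F c' q" using nbrsD(8)[OF fD(16), of q] ra eD(6,7) qr by auto
    moreover have "F b q < F p q"
      using flip_ini[of p b "touch a b" q] ac u ra fD(2) eD qr by auto
    ultimately show False using y by simp
  qed
  show "F p (touch a b) < F a (touch a b) \<and> F a (touch p c) < F p (touch p c)"
    if u: "touch a b \<le> E p" "\<not> F a (touch a b) < F p (touch a b)"
  proof
    have "F a (touch a b) \<noteq> F p (touch a b)"
      using triple[of a p b "touch a b"] ne ap fD(2) eD u(1) by auto
    then show "F p (touch a b) < F a (touch a b)" using u by simp
    have tp: "touch p c \<le> E a" "r \<le> E a" "r < q" "r < E b" "r < E c" using eD fD d1 qr by auto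
    have "F p (touch p c) \<noteq> F a (touch p c)"
      using triple[of a p c "touch p c"] ne ap fD eD(2) tp by auto
    moreover have "\<not> F p (touch p c) < F a (touch p c)"
    proof
      assume "F p (touch p c) < F a (touch p c)"
      then have "F c r < F a r"
        using flip_ini[of a c "touch p c" r] ac fD eD(2) tp qr by auto
      moreover have "F a r \<le> F b r" using ba(8)[of r] tp fD qr by auto
      ultimately have "step q b c"
        using d1 eD(3) fD(3,6,7) tp qr by (intro stepI[of b c r q]) auto
      then show False using d1 reach_step by blast
    qed
    ultimately show "F a (touch p c) < F p (touch p c)" by simp
  qed
qed

definition down_class :: "'c \<Rightarrow> 'c \<Rightarrow> ('c \<times> 'c) \<times> ('c \<times> 'c) \<Rightarrow> bool \<times> bool \<times> bool \<times> bool" where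
  "down_class a p = (\<lambda>((b, b'), (c, c')). (E p < touch a b, F a (touch a b) < F p (touch a b),
     touch a b < touch p c, F p (cross_time c c') < F a (cross_time c c')))"

lemma down_class_less:
  assumes e: "consec a b b'" and f: "consec p c c'" and dc: "down_conflict (b, b') (c, c')"
    and e2: "consec a d d'" and f2: "consec p g g'" and dc2: "down_conflict (d, d') (g, g')"
    and lt: "touch p c < touch p g" and ap: "a \<noteq> p"
    and cl: "down_class a p ((b, b'), (c, c')) = down_class a p ((d, d'), (g, g'))"
  shows False
proof -
  define q r q2 r2 where qr: "q = cross_time b b'" "r = cross_time c c'" "q2 = cross_time d d'" "r2 = cross_time g g'"
  define t t2 u u2 where tu: "t = touch a b" "t2 = touch a d" "u = touch p c" "u2 = touch p g"
  note eD = consecD[OF e] and fD = consecD[OF f] and e2D = consecD[OF e2] and f2D = consecD[OF f2]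
  note s1 = down_single[OF e f dc ap, folded qr tu] and s2 = down_single[OF e2 f2 dc2 ap, folded qr tu]
  have cl': "E p < t \<longleftrightarrow> E p < t2" "F a t < F p t \<longleftrightarrow> F a t2 < F p t2" "t < u \<longleftrightarrow> t2 < u2"
    "F p r < F a r \<longleftrightarrow> F p r2 < F a r2"
    using cl by (auto simp: down_class_def qr tu)
  have o: "s0 \<le> t" "s0 \<le> u" "t < q" "q < t2" "t2 < q2" "q2 \<le> E a" "u < r" "r < u2" "u2 < r2" "r2 \<le> E p"
    "t < r2" "r < q" "r2 < q2"
    using down_pair[OF e f dc e2 f2 dc2 lt] eD fD e2D f2D consec_next[OF f f2D(15) lt] s1(1) s2(1)
    by (auto simp: qr tu)
  have ap': "a \<in> A \<union> B" "p \<in> A \<union> B" "p \<noteq> a" using eD fD ap by auto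
  have nA: "t \<le> E p" "t2 \<le> E p" using o cl' by auto
  have nB: "\<not> F a t < F p t" "\<not> F a t2 < F p t2" using s1(2) cl' nA o by auto
  have c: "F a u < F p u" "F p t < F a t" "F a u2 < F p u2" "F p t2 < F a t2"
    using s1(3) s2(3) nA nB by auto
  show False
  proof (cases "t < u")
    case True
    then show False using flip[of p a t u t2] c o ap' nA by auto
  next
    case False
    then have tu': "u \<le> t" "u2 \<le> t2" using cl' by auto
    show False
    proof (cases "F p r < F a r")
      case True
      then show False using flip[of a p u r u2] c o ap' nA by auto
    next
      case nq: False
      then show False using flip[of a p u t r2] c o ap' nA tu' cl' by auto
    qed
  qed
qed

lemma down_class_inj:
  assumes "a \<noteq> p"
  shows "inj_on (down_class a p) {((b, b'), (c, c')). consec a b b' \<and> consec p c c' \<and> down_conflict (b, b') (c, c')}"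
proof (rule inj_onI)
  fix y z
  assume "y \<in> {((b, b'), (c, c')). consec a b b' \<and> consec p c c' \<and> down_conflict (b, b') (c, c')}"
    and "z \<in> {((b, b'), (c, c')). consec a b b' \<and> consec p c c' \<and> down_conflict (b, b') (c, c')}"
    and yz: "down_class a p y = down_class a p z"
  then obtain b b' c c' d d' g g' where y: "y = ((b, b'), (c, c'))" and z: "z = ((d, d'), (g, g'))"
    and e: "consec a b b'" and f: "consec p c c'" and dc: "down_conflict (b, b') (c, c')"
    and e2: "consec a d d'" and f2: "consec p g g'" and dc2: "down_conflict (d, d') (g, g')"
    by auto
  have cl: "down_class a p ((b, b'), (c, c')) = down_class a p ((d, d'), (g, g'))"
    using yz y z by simp
  have "touch p c = touch p g"
    using down_class_less[OF e f dc e2 f2 dc2 _ assms cl]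
      down_class_less[OF e2 f2 dc2 e f dc _ assms cl[symmetric]] by (meson linorder_less_linear)
  then have cg: "c = g" using touch_inj consecD(15) f f2 by blast
  then have c'g': "c' = g'" using consec_unique f f2 by blast
  have i: "ini b c" "ini c b'" "ini d g" "ini g d'"
    using dc dc2 ini_trans by (auto simp: down_conflict_def)
  have "\<not> touch a b' \<le> touch a d"
  proof
    assume "touch a b' \<le> touch a d"
    then have "b' = d \<or> ini b' d"
      using touch_inj touch_ini consecD(15)[OF e2] consecD(16)[OF e] by fastforce
    then show False using i cg ini_trans ini_asym by blast
  qed
  then show "y = z"
    using gap_order[OF e e2, of c g] i cg c'g' y z by auto
qed

section \<open>The number of edges and their multiplicities\<close>

definition edges :: "('c \<times> 'c) set" where
  "edges = {(b, b'). \<exists>a. consec a b b'}"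

definition conflicts :: "(('c \<times> 'c) \<times> ('c \<times> 'c)) set" where
  "conflicts = {(e, f). e \<in> edges \<and> f \<in> edges \<and> (up_conflict e f \<or> down_conflict e f)}"

lemma edges_subset: "edges \<subseteq> B \<times> B"
  using consecD(3,4) by (auto simp: edges_def)

lemma finite_edges: "finite edges"
  using edges_subset finB finite_subset by blast

lemma finite_conflicts: "finite conflicts"
  by (rule finite_subset[of _ "edges \<times> edges"]) (auto simp: conflicts_def finite_edges)

lemma conflict_order:
  assumes "up_conflict (b, b') (c, c') \<or> down_conflict (b, b') (c, c')"
  shows "ini b c" "ini c b'"
  using assms ini_trans by (auto simp: up_conflict_def down_conflict_def)

text \<open>A conflict puts \<open>c\<close> initially between \<open>b\<close> and
  \<open>b'\<close>, but no curve of the chain lies between two consecutive ones.\<close>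

lemma no_self_conflict:
  assumes e: "consec a b b'" and f: "consec a c c'"
  shows "\<not> (up_conflict (b, b') (c, c') \<or> down_conflict (b, b') (c, c'))"
proof
  assume "up_conflict (b, b') (c, c') \<or> down_conflict (b, b') (c, c')"
  note i = conflict_order[OF this]
  show False
    using i touch_ini[OF consecD(15)[OF e] consecD(15)[OF f]] touch_ini[OF consecD(15)[OF f] consecD(16)[OF e]]
      consecD(15)[OF f] e by (auto simp: consec_def)
qed

lemma card_conflicts: "card conflicts \<le> 32 * (card A)\<^sup>2"
proof -
  \<comment> \<open>Edges are counted without multiplicity, so one lower curve per edge suffices: a
    conflict is charged to the representatives of its two edges, at most 16 conflicts of each kind
    to an ordered pair.\<close>
  define rep where "rep = (\<lambda>(b, b'). SOME a. consec a b b')"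
  have rep: "consec (rep (b, b')) b b'" if "(b, b') \<in> edges" for b b'
    using that someI_ex[of "\<lambda>a. consec a b b'"] by (auto simp: edges_def rep_def)
  define U where "U = (UNIV :: (bool \<times> bool \<times> bool \<times> bool) set)"
  have cU: "card ((A \<times> A) \<times> U) = 16 * (card A)\<^sup>2"
    by (simp add: U_def card_cartesian_product power2_eq_square flip: UNIV_Times_UNIV)
  have fU: "finite ((A \<times> A) \<times> U)" using finA by (simp add: U_def)
  have main: "card {(e, f). e \<in> edges \<and> f \<in> edges \<and> R e f} \<le> 16 * (card A)\<^sup>2"
    if R: "\<And>e f. R e f \<Longrightarrow> up_conflict e f \<or> down_conflict e f"
      and cls: "\<And>a p. a \<noteq> p \<Longrightarrow>
        inj_on (cls a p) {((b, b'), (c, c')). consec a b b' \<and> consec p c c' \<and> R (b, b') (c, c')}"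
    for R and cls :: "'c \<Rightarrow> 'c \<Rightarrow> ('c \<times> 'c) \<times> ('c \<times> 'c) \<Rightarrow> bool \<times> bool \<times> bool \<times> bool"
  proof -
    let ?X = "{(e, f). e \<in> edges \<and> f \<in> edges \<and> R e f}"
    let ?h = "\<lambda>(e, f). ((rep e, rep f), cls (rep e) (rep f) (e, f))"
    have "inj_on ?h ?X"
    proof (rule inj_onI)
      fix x y assume x: "x \<in> ?X" and y: "y \<in> ?X" and h: "?h x = ?h y"
      obtain b b' c c' d d' g g' where xy: "x = ((b, b'), (c, c'))" "y = ((d, d'), (g, g'))"
        by (metis surj_pair)
      define a p where "a = rep (b, b')" and "p = rep (c, c')"
      have cs: "consec a b b'" "consec p c c'" "consec a d d'" "consec p g g'"
        using rep[of b b'] rep[of c c'] rep[of d d'] rep[of g g'] x y h xy by (auto simp: a_def p_def)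
      have RR: "R (b, b') (c, c')" "R (d, d') (g, g')" using x y xy by auto
      have "a \<noteq> p" using no_self_conflict cs R RR by blast
      from inj_onD[OF cls[OF this], of x y] show "x = y"
        using cs RR xy h by (auto simp: a_def p_def)
    qed
    moreover have "?h ` ?X \<subseteq> (A \<times> A) \<times> U"
      using rep consecD(2) by (fastforce simp: U_def)
    ultimately show ?thesis using card_inj_on_le[OF _ _ fU, of ?h ?X] cU by simp
  qed
  have "conflicts = {(e, f). e \<in> edges \<and> f \<in> edges \<and> up_conflict e f} \<union>
      {(e, f). e \<in> edges \<and> f \<in> edges \<and> down_conflict e f}"
    by (auto simp: conflicts_def)
  then have "card conflicts \<le> card {(e, f). e \<in> edges \<and> f \<in> edges \<and> up_conflict e f} +
      card {(e, f). e \<in> edges \<and> f \<in> edges \<and> down_conflict e f}"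
    by (simp only: card_Un_le)
  also have "\<dots> \<le> 16 * (card A)\<^sup>2 + 16 * (card A)\<^sup>2"
    using main[of up_conflict up_class] main[of down_conflict down_class] up_class_inj down_class_inj
    by (intro add_mono) auto
  finally show ?thesis by simp
qed

lemma conflicts_distinct:
  assumes "((b, b'), (c, c')) \<in> conflicts"
  shows "card {b, b', c, c'} = 4"
proof -
  obtain a p where e: "consec a b b'" and f: "consec p c c'"
    and uc: "up_conflict (b, b') (c, c') \<or> down_conflict (b, b') (c, c')"
    using assms by (auto simp: conflicts_def edges_def)
  note i = conflict_order[OF uc]
  have "b' \<noteq> c'" using uc up_conflict_distinct[OF e f] down_conflict_distinct[OF e f] by blast
  moreover have "b \<noteq> c'" "b \<noteq> c" "c \<noteq> b'" "b \<noteq> b'" "c \<noteq> c'"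
    using i consecD(5)[OF e] consecD(5)[OF f] ini_trans ini_neq by blast+
  ultimately show ?thesis by auto
qed

lemma card_edges:
  assumes "K \<ge> 1"
  shows "card edges * K ^ 2 \<le> 3 * card B * K ^ 3 + 32 * (card A)\<^sup>2"
proof -
  have "card edges * K ^ 2 \<le> 3 * card B * K ^ 3 + card conflicts"
  proof (rule sampling_bound[OF finB edges_subset _ _ conflicts_distinct _ assms])
    show "\<And>b c. (b, c) \<in> edges \<Longrightarrow> b \<noteq> c"
      using consecD(5) ini_neq unfolding edges_def by blast
    show "conflicts \<subseteq> edges \<times> edges" by (auto simp: conflicts_def)
    fix V assume V: "V \<subseteq> B"
    let ?S = "{e \<in> edges. e \<in> V \<times> V}"
    let ?X = "{x \<in> conflicts. fst x \<in> V \<times> V \<and> snd x \<in> V \<times> V}"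
    \<comment> \<open>Deleting the first edge of every conflict inside \<open>V\<close> leaves a
      conflict-free set.\<close>
    have "card (?S - fst ` ?X) \<le> 3 * card V"
    proof (rule conflict_free_bound[OF V])
      show "\<And>b c. (b, c) \<in> ?S - fst ` ?X \<Longrightarrow> crossing_pair b c"
        using consecD(1) by (auto simp: edges_def)
      show "\<not> up_conflict e f \<and> \<not> down_conflict e f" if "e \<in> ?S - fst ` ?X" "f \<in> ?S - fst ` ?X" for e f
      proof (rule ccontr)
        assume "\<not> ?thesis"
        then have "(e, f) \<in> ?X" using that by (auto simp: conflicts_def)
        then show False using that(1) by force
      qed
    qed auto
    moreover have "card (fst ` ?X) \<le> card ?X"
      by (rule card_image_le) (use finite_conflicts in auto)
    moreover have "card ?S \<le> card (?S - fst ` ?X) + card (fst ` ?X)"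
      using diff_card_le_card_Diff[of "fst ` ?X" ?S] finite_conflicts by simp
    ultimately show "card ?S \<le> 3 * card V + card ?X" by simp
  qed
  then show ?thesis using card_conflicts by simp
qed

text \<open>When \<open>a\<close> touches \<open>b\<close>, it is above \<open>p\<close>; when
  \<open>p\<close> touches \<open>b\<close>, the order is reversed for good. If \<open>p\<close>
  were alive when \<open>a\<close> touches \<open>b'\<close>, it would be above \<open>a\<close> and
  hence above \<open>b'\<close>, which it never passes.\<close>

lemma parallel_nested:
  assumes e: "consec a b b'" and f: "consec p b b'" and lt: "touch a b < touch p b"
  shows "E p < touch a b'"
proof (rule ccontr)
  assume n: "\<not> ?thesis"
  note eD = consecD[OF e] and fD = consecD[OF f]
  note pb = nbrsD[OF fD(15)] nbrsD[OF fD(16)] and ab = nbrsD[OF eD(15)]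
  have "a \<noteq> p" using lt by auto
  have 1: "F p (touch a b) < F a (touch a b)" using pb(9)[of "touch a b"] eD(6,13) fD(7-9) lt by auto
  have 2: "F a (touch p b) < F p (touch p b)" using ab(9)[of "touch p b"] eD(7-9) fD(6-9,13) lt by auto
  have "F a (touch a b') < F p (touch a b')"
    using flip[of p a "touch a b" "touch p b" "touch a b'"] 1 2 \<open>a \<noteq> p\<close> lt n eD fD by auto
  moreover have "F p (touch a b') \<le> F b' (touch a b')"
    using nbrsD(8)[OF fD(16), of "touch a b'"] n eD by auto
  ultimately show False using eD(14) by simp
qed

text \<open>All touches in the remaining life of \<open>a\<close> are counted, by whatever lower
  curve, including those where the upper curve ends first. The count depends on a time interval
  only, so those of disjoint intervals add up.\<close>

definition future :: "'c \<Rightarrow> 'c \<Rightarrow> ('c \<times> 'c) set" where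
  "future a b = {(x, y). touches x y \<and> touch a b \<le> touch x y \<and> touch x y \<le> E a}"

lemma future_subset: "future a b \<subseteq> A \<times> B"
  using touches_mem by (auto simp: future_def)

lemma finite_future: "finite (future a b)"
  using future_subset finA finB finite_subset by blast

lemma future_self: "b \<in> nbrs a \<Longrightarrow> (a, b) \<in> future a b"
  using nbrsD(4) by (auto simp: future_def nbrs_def)

lemma future_pos: "b \<in> nbrs a \<Longrightarrow> 1 \<le> card (future a b)"
  using future_self finite_future by (metis One_nat_def Suc_leI card_gt_0_iff empty_iff)

lemma future_mono: "touch a b \<le> touch a b' \<Longrightarrow> card (future a b') \<le> card (future a b)"
  by (intro card_mono finite_future) (auto simp: future_def)

text \<open>By nesting, the interval from \<open>touch p b\<close> to \<open>E p\<close> lies after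
  \<open>touch a b\<close> and before \<open>touch a b'\<close>.\<close>

lemma parallel_future:
  assumes e: "consec a b b'" and f: "consec p b b'" and lt: "touch a b < touch p b"
  shows "card (future a b') + card (future p b) \<le> card (future a b)"
proof -
  note n = parallel_nested[OF assms] and eD = consecD[OF e]
  have "card (future a b') + card (future p b) = card (future a b' \<union> future p b)"
    by (rule card_Un_disjoint[symmetric]) (use n finite_future in \<open>auto simp: future_def\<close>)
  also have "\<dots> \<le> card (future a b)"
    by (rule card_mono[OF finite_future]) (use n lt eD(7-9) in \<open>auto simp: future_def\<close>)
  finally show ?thesis .
qed

text \<open>The potential \<open>card (future a b)\<close> drops by a definite factor along a steep edge, so a curve
  has few of them. Along a non-steep edge shared by nested curves it grows geometrically from the
  inside to the outside, so there are few such curves.\<close>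
definition steep :: "nat \<Rightarrow> 'c \<Rightarrow> 'c \<Rightarrow> 'c \<Rightarrow> bool" where
  "steep \<rho> a b b' \<longleftrightarrow> consec a b b' \<and> (\<rho> + 1) * card (future a b') \<le> \<rho> * card (future a b)"

section \<open>Counting steep and nonsteep edges\<close>

lemma finite_nbrs: "finite (nbrs a)"
  using finB by (auto simp: nbrs_def)

lemma consec_exists:
  assumes "b \<in> nbrs a" "d \<in> nbrs a" "touch a b < touch a d"
  shows "\<exists>b'. consec a b b'"
proof -
  let ?S = "{d \<in> nbrs a. touch a b < touch a d}"
  have S: "finite ?S" "?S \<noteq> {}" using finite_nbrs assms by auto
  define b' where "b' = arg_min_on (touch a) ?S"
  have "b' \<in> ?S" using arg_min_if_finite(1)[OF S] by (simp add: b'_def)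
  moreover have "touch a b' \<le> touch a x" if "x \<in> ?S" for x
    using arg_min_least[OF S that] by (simp add: b'_def)
  ultimately show ?thesis using assms(1) unfolding consec_def by (intro exI[of _ b']) force
qed

text \<open>Going backwards along the chain, each steep edge multiplies the number of touches to
  come by at least 1 + 1/\<rho>, and this number is at least 1 at the last curve. The inequality
  says this with denominators cleared.\<close>

lemma steep_power:
  assumes "b \<in> nbrs a"
  shows "(\<rho> + 1) ^ card {d. (\<exists>d'. steep \<rho> a d d') \<and> touch a b \<le> touch a d} \<le>
     \<rho> ^ card {d. (\<exists>d'. steep \<rho> a d d') \<and> touch a b \<le> touch a d} * card (future a b)"
  using assms
proof (induction "card {d \<in> nbrs a. touch a b < touch a d}" arbitrary: b rule: less_induct)
  case less
  let ?G = "\<lambda>b. {d. (\<exists>d'. steep \<rho> a d d') \<and> touch a b \<le> touch a d}"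
  have fG: "finite (?G b)" for b
    by (rule finite_subset[OF _ finite_nbrs]) (auto simp: steep_def dest: consecD)
  show ?case
  proof (cases "\<exists>b'. consec a b b'")
    case False
    have "?G b = {}"
    proof (rule ccontr)
      assume "?G b \<noteq> {}"
      then obtain d d' where d: "consec a d d'" "touch a b \<le> touch a d" by (auto simp: steep_def)
      note dD = consecD[OF d(1)]
      have "touch a b < touch a d'" using d dD(7,8) by auto
      then show False using consec_exists[OF less.prems dD(16)] False by blast
    qed
    then show ?thesis
      using future_pos[OF less.prems] by (simp only: card.empty power_0 mult_1)
  next
    case True
    then obtain b' where b': "consec a b b'" by blast
    note bD = consecD[OF b']
    have lt: "touch a b < touch a b'" using bD by auto
    have "{d \<in> nbrs a. touch a b' < touch a d} \<subset> {d \<in> nbrs a. touch a b < touch a d}"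
      using lt bD(16) by auto
    then have IH: "(\<rho> + 1) ^ card (?G b') \<le> \<rho> ^ card (?G b') * card (future a b')"
      using less.hyps[of b'] bD(16) finite_nbrs by (simp add: psubset_card_mono)
    have Gb: "?G b = ?G b' \<union> (if steep \<rho> a b b' then {b} else {})"
    proof (intro equalityI subsetI)
      fix d assume "d \<in> ?G b"
      then obtain d' where d: "steep \<rho> a d d'" "touch a b \<le> touch a d" by auto
      have dn: "d \<in> nbrs a" using d consecD(15) by (auto simp: steep_def)
      show "d \<in> ?G b' \<union> (if steep \<rho> a b b' then {b} else {})"
      proof (cases "touch a b = touch a d")
        case True
        then have "d = b" using touch_inj[OF less.prems dn] by simp
        moreover have "d' = b'" using d b' consec_unique[of a b d' b'] calculation by (auto simp: steep_def)
        ultimately show ?thesis using d by auto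
      next
        case False
        then have "touch a b' \<le> touch a d" using consec_next[OF b' dn] d by simp
        then show ?thesis using d by auto
      qed
    qed (use lt in \<open>auto split: if_splits\<close>)
    show ?thesis
    proof (cases "steep \<rho> a b b'")
      case True
      have "b \<notin> ?G b'" using lt by auto
      then have c: "card (?G b) = Suc (card (?G b'))" using Gb True fG[of b'] by simp
      have "(\<rho> + 1) ^ card (?G b) \<le> (\<rho> + 1) * (\<rho> ^ card (?G b') * card (future a b'))"
        unfolding c power_Suc by (rule mult_left_mono[OF IH]) simp
      also have "\<dots> = \<rho> ^ card (?G b') * ((\<rho> + 1) * card (future a b'))" by (simp add: algebra_simps)
      also have "\<dots> \<le> \<rho> ^ card (?G b') * (\<rho> * card (future a b))"
        using True by (intro mult_left_mono) (auto simp: steep_def)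
      also have "\<dots> = \<rho> ^ card (?G b) * card (future a b)" unfolding c by simp
      finally show ?thesis .
    next
      case False
      then have eq: "?G b = ?G b'" using Gb by simp
      have "\<rho> ^ card (?G b') * card (future a b') \<le> \<rho> ^ card (?G b') * card (future a b)"
        using lt by (intro mult_left_mono future_mono) auto
      with IH show ?thesis unfolding eq by (rule order_trans)
    qed
  qed
qed

lemma steep_count:
  assumes M: "M \<ge> 1" "card A \<le> M ^ 12" "card B \<le> M ^ 12"
  shows "card {d. \<exists>d'. steep (M ^ 3) a d d'} \<le> 24 * M ^ 4"
proof (cases "nbrs a = {}")
  case True
  then have "{d. \<exists>d'. steep (M ^ 3) a d d'} = {}" using consecD(15) by (auto simp: steep_def)
  then show ?thesis by simp
next
  case False
  define b where "b = arg_min_on (touch a) (nbrs a)"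
  have b: "b \<in> nbrs a" using arg_min_if_finite(1)[OF finite_nbrs False] by (simp add: b_def)
  have le: "touch a b \<le> touch a d" if "d \<in> nbrs a" for d
    using arg_min_least[OF finite_nbrs False that] by (simp add: b_def)
  have eq: "{d. (\<exists>d'. steep (M ^ 3) a d d') \<and> touch a b \<le> touch a d} = {d. \<exists>d'. steep (M ^ 3) a d d'}"
    using le consecD(15) by (auto simp: steep_def)
  have "card (future a b) \<le> card A * card B"
    using card_mono[OF _ future_subset[of a b]] finA finB by (simp add: card_cartesian_product)
  also have "\<dots> \<le> M ^ 12 * M ^ 12" using M by (intro mult_mono) auto
  finally have "card (future a b) \<le> M ^ 24" by (simp flip: power_add)
  then have "(M ^ 3 + 1) ^ card {d. \<exists>d'. steep (M ^ 3) a d d'} \<le>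
      (M ^ 3) ^ card {d. \<exists>d'. steep (M ^ 3) a d d'} * M ^ 24"
    using steep_power[OF b, of "M ^ 3", unfolded eq] by (meson mult_left_mono order_trans zero_le)
  then show ?thesis using power_ratio_bound[OF M(1)] by blast
qed

text \<open>Along a nonsteep edge more than the fraction \<rho>/(\<rho>+1) of the touches to come
  remain from \<open>b'\<close> on. Those of the nested curve \<open>p\<close> have to fit into the
  rest, less than 1/(\<rho>+1) of the total.\<close>

lemma nonsteep_separated:
  assumes e: "consec a b b'" and f: "consec p b b'" and ns: "\<not> steep \<rho> a b b'" and lt: "touch a b < touch p b"
  shows "\<rho> * card (future p b) < card (future a b)"
proof -
  have "\<rho> * card (future a b) < (\<rho> + 1) * card (future a b')" using ns e by (simp add: steep_def)
  moreover have "(\<rho> + 1) * (card (future a b') + card (future p b)) \<le> (\<rho> + 1) * card (future a b)"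
    using parallel_future[OF e f lt] by (intro mult_left_mono) auto
  ultimately have "(\<rho> + 1) * card (future p b) < card (future a b)" by (simp add: algebra_simps)
  then show ?thesis by simp
qed

text \<open>Users of the same edge touch \<open>b\<close> at distinct times, as no three curves
  meet, so any two are nested and hence separated by the factor \<open>M ^ 3\<close>. Their weights
  are at most \<open>M ^ 24\<close>, the eighth power of that factor.\<close>

lemma nonsteep_count:
  assumes M: "M \<ge> 1" "card A \<le> M ^ 12" "card B \<le> M ^ 12"
  shows "card {a. consec a b b' \<and> \<not> steep (M ^ 3) a b b'} \<le> 9"
proof (rule geometric_card_bound[of _ "\<lambda>a. card (future a b)" "M ^ 3"])
  let ?S = "{a. consec a b b' \<and> \<not> steep (M ^ 3) a b b'}"
  show "finite ?S" by (rule finite_subset[OF _ finA]) (auto dest: consecD)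
  show "1 \<le> M ^ 3" using M by simp
  fix a assume a: "a \<in> ?S"
  have "card (future a b) \<le> card A * card B"
    using card_mono[OF _ future_subset[of a b]] finA finB by (simp add: card_cartesian_product)
  also have "\<dots> \<le> M ^ 12 * M ^ 12" using M by (intro mult_mono) auto
  also have "\<dots> = (M ^ 3) ^ 8" by (simp flip: power_add power_mult)
  finally show "1 \<le> card (future a b) \<and> card (future a b) \<le> (M ^ 3) ^ 8"
    using a future_pos consecD(15) by auto
  fix p assume p: "p \<in> ?S" "a \<noteq> p"
  have c: "consec a b b'" "consec p b b'" using a p by auto
  have "touch a b \<noteq> touch p b"
  proof
    assume t: "touch a b = touch p b"
    note aD = nbrsD(1-7)[OF consecD(15)[OF c(1)]] and pD = nbrsD(1-7)[OF consecD(15)[OF c(2)]]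
    have "F b (touch a b) = F a (touch a b)" "F b (touch a b) = F p (touch a b)"
      using aD(6) pD(6) t by simp_all
    then show False
      using triple[of b a p "touch a b"] aD(1-5,7) pD(1-5,7) p(2) t by auto
  qed
  then show "M ^ 3 * card (future a b) < card (future p b) \<or> M ^ 3 * card (future p b) < card (future a b)"
    using nonsteep_separated[of a b b' p "M ^ 3"] nonsteep_separated[of p b b' a "M ^ 3"] c a p
    by (auto simp: neq_iff)
qed

text \<open>A touch is the last on its chain, or starts a steep edge, or starts a nonsteep one: 340
  = 1 + 24 + 9 * 35. The sampling parameter \<open>K = M ^ 4\<close> balances the two terms of
  \<open>card_edges\<close> at order \<open>M ^ 24\<close>, whence 35 = 3 + 32.\<close>

lemma card_long_tangencies:
  assumes M: "M \<ge> 1" "card A \<le> M ^ 12" "card B \<le> M ^ 12"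
  shows "card {(a, b). b \<in> nbrs a} \<le> 340 * M ^ 16"
proof -
  let ?P = "{(a, b). b \<in> nbrs a}"
  define P0 where "P0 = {(a, b). b \<in> nbrs a \<and> (\<forall>b'. \<not> consec a b b')}"
  define P1 where "P1 = {(a, b). \<exists>b'. steep (M ^ 3) a b b'}"
  define P2 where "P2 = {(a, b, b'). consec a b b' \<and> \<not> steep (M ^ 3) a b b'}"
  have "?P \<subseteq> P0 \<union> P1 \<union> (\<lambda>(a, b, b'). (a, b)) ` P2"
    unfolding P0_def P1_def P2_def by (auto simp: image_iff)
  moreover have fP: "finite ?P"
    by (rule finite_subset[of _ "A \<times> B"]) (use finA finB nbrsD in auto)
  moreover have f0: "finite P0" "finite P1"
    by (rule finite_subset[OF _ fP]; auto simp: P0_def P1_def steep_def dest: consecD)+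
  moreover have f2: "finite P2"
    by (rule finite_subset[of _ "A \<times> B \<times> B"]) (use finA finB in \<open>auto simp: P2_def dest: consecD\<close>)
  ultimately have "card ?P \<le> card (P0 \<union> P1 \<union> (\<lambda>(a, b, b'). (a, b)) ` P2)"
    by (intro card_mono) auto
  also have "\<dots> \<le> card P0 + card P1 + card P2"
    using card_Un_le[of "P0 \<union> P1" "(\<lambda>(a, b, b'). (a, b)) ` P2"] card_Un_le[of P0 P1]
      card_image_le[OF f2, of "\<lambda>(a, b, b'). (a, b)"] by linarith
  also have "card P0 \<le> M ^ 12"
  proof -
    have "inj_on fst P0"
    proof (rule inj_onI)
      fix x y assume "x \<in> P0" "y \<in> P0" "fst x = fst y"
      then obtain a b d where xy: "x = (a, b)" "y = (a, d)" "b \<in> nbrs a" "d \<in> nbrs a"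
        "\<And>b'. \<not> consec a b b'" "\<And>b'. \<not> consec a d b'" by (auto simp: P0_def)
      then have "touch a b = touch a d"
        using consec_exists[of b a d] consec_exists[of d a b] by (meson linorder_less_linear)
      then show "x = y" using touch_inj xy by blast
    qed
    then have "card P0 \<le> card A"
      using nbrsD(1) finA by (intro card_inj_on_le[of fst]) (auto simp: P0_def)
    then show ?thesis using M by simp
  qed
  also have "card P1 \<le> M ^ 12 * (24 * M ^ 4)"
  proof -
    have "P1 = (SIGMA a:A. {b. \<exists>b'. steep (M ^ 3) a b b'})"
      using consecD(2) by (auto simp: P1_def steep_def)
    moreover have "finite {b. \<exists>b'. steep (M ^ 3) a b b'}" for a
      by (rule finite_subset[OF _ finB]) (auto simp: steep_def dest: consecD)
    ultimately have "card P1 = (\<Sum>a\<in>A. card {b. \<exists>b'. steep (M ^ 3) a b b'})"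
      using finA by (simp add: card_SigmaI)
    also have "\<dots> \<le> (\<Sum>a\<in>A. 24 * M ^ 4)" by (rule sum_mono) (rule steep_count[OF M])
    also have "\<dots> \<le> M ^ 12 * (24 * M ^ 4)" using M by (simp add: mult_right_mono)
    finally show ?thesis .
  qed
  also have "card P2 \<le> 9 * (35 * M ^ 16)"
  proof -
    have "P2 = (\<lambda>((b, b'), a). (a, b, b')) ` (SIGMA e:edges. {a. consec a (fst e) (snd e) \<and> \<not> steep (M ^ 3) a (fst e) (snd e)})"
      by (auto simp: P2_def edges_def image_iff)
    moreover have fe: "finite {a. consec a b b' \<and> \<not> steep (M ^ 3) a b b'}" for b b'
      by (rule finite_subset[OF _ finA]) (auto dest: consecD)
    ultimately have "card P2 \<le> card (SIGMA e:edges. {a. consec a (fst e) (snd e) \<and> \<not> steep (M ^ 3) a (fst e) (snd e)})"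
      using finite_edges by (simp only:) (intro card_image_le finite_SigmaI; simp)
    also have "\<dots> = (\<Sum>e\<in>edges. card {a. consec a (fst e) (snd e) \<and> \<not> steep (M ^ 3) a (fst e) (snd e)})"
      using finite_edges fe by (simp add: card_SigmaI)
    also have "\<dots> \<le> (\<Sum>e\<in>edges. 9)" by (rule sum_mono) (rule nonsteep_count[OF M])
    also have "\<dots> = 9 * card edges" by simp
    also have "card edges \<le> 35 * M ^ 16"
    proof -
      have "card edges * (M ^ 4) ^ 2 \<le> 3 * card B * (M ^ 4) ^ 3 + 32 * (card A)\<^sup>2"
        using M by (intro card_edges) simp
      also have "\<dots> \<le> 3 * M ^ 12 * (M ^ 4) ^ 3 + 32 * (M ^ 12)\<^sup>2"
        using M by (intro add_mono mult_mono power_mono) auto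
      also have "\<dots> = 35 * M ^ 24" by (simp flip: power_mult power_add)
      also have "\<dots> = (35 * M ^ 16) * (M ^ 4) ^ 2" by (simp flip: power_mult power_add)
      finally show ?thesis using M by (simp only: mult_le_cancel2) simp
    qed
    finally show ?thesis by simp
  qed
  finally have "card ?P \<le> M ^ 12 + M ^ 12 * (24 * M ^ 4) + 9 * (35 * M ^ 16)" by simp
  moreover have "M ^ 12 \<le> M ^ 16" using M by (intro power_increasing) auto
  moreover have "M ^ 12 * (24 * M ^ 4) = 24 * M ^ 16" by (simp flip: power_add)
  ultimately show ?thesis by simp
qed

section \<open>Reflection exchanging the two families\<close>

lemma mirror: "tangency_family B A (\<lambda>c s. - F c s) E s0 (\<lambda>b a. touches a b)"
proof
  fix c d g s
  assume "c \<in> B \<union> A" "d \<in> B \<union> A" "g \<in> B \<union> A" "c \<noteq> d" "c \<noteq> g" "d \<noteq> g" "s0 \<le> s"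
    "s \<le> E c" "s \<le> E d" "s \<le> E g" "- F c s = - F d s" "- F c s = - F g s"
  then show False using triple[of c d g s] by auto
next
  fix c d s u
  assume "c \<in> B \<union> A" "d \<in> B \<union> A" "c \<noteq> d" "s0 \<le> s" "s \<le> E c" "s \<le> E d"
    "s0 \<le> u" "u \<le> E c" "u \<le> E d" "- F c s = - F d s" "- F c u = - F d u"
  then show "s = u" using once[of c d s u] by auto
next
  show "finite B" "finite A" "B \<inter> A = {}" using finA finB disj by auto
  show "s0 \<le> E c" if "c \<in> B \<union> A" for c using start that by auto
  show "continuous_on {s0..E c} (\<lambda>s. - F c s)" if "c \<in> B \<union> A" for c
    using cont[of c] that by (intro continuous_on_minus) auto
  show "c = d" if "c \<in> B \<union> A" "d \<in> B \<union> A" "- F c s0 = - F d s0" for c d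
    using init[of c d] that by auto
  show "- F b s0 < - F a s0" if "b \<in> B" "a \<in> A" for a b using AB that by simp
  show "b \<in> B \<and> a \<in> A" if "touches a b" for a b using touches_mem that by simp
  show "- F b s \<le> - F a s" if "touches a b" "s0 \<le> s" "s \<le> E b" "s \<le> E a" for a b s
    using touches_le that by simp
  show "\<exists>s. s0 \<le> s \<and> s \<le> E b \<and> s \<le> E a \<and> - F b s = - F a s" if ab: "touches a b" for a b
  proof -
    obtain s where "s0 \<le> s" "s \<le> E a" "s \<le> E b" "F a s = F b s" using touches_eq[OF ab] by blast
    then show ?thesis by (intro exI[of _ s]) simp
  qed
qed

lemma card_tangencies:
  assumes M: "M \<ge> 1" "card A \<le> M ^ 12" "card B \<le> M ^ 12"
  shows "card {(a, b). touches a b} \<le> 680 * M ^ 16"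
proof -
  interpret mirror: tangency_family B A "\<lambda>c s. - F c s" E s0 "\<lambda>b a. touches a b" by (rule mirror)
  have f1: "finite {(a, b). b \<in> nbrs a}"
    by (rule finite_subset[of _ "A \<times> B"]) (use finA finB nbrsD(1,2) in auto)
  have f2: "finite {(b, a). a \<in> mirror.nbrs b}"
    by (rule finite_subset[of _ "B \<times> A"]) (use finA finB mirror.nbrsD(1,2) in auto)
  have "{(a, b). touches a b} \<subseteq> {(a, b). b \<in> nbrs a} \<union> prod.swap ` {(b, a). a \<in> mirror.nbrs b}"
  proof
    fix x assume "x \<in> {(a, b). touches a b}"
    then obtain a b where x: "x = (a, b)" "touches a b" by blast
    show "x \<in> {(a, b). b \<in> nbrs a} \<union> prod.swap ` {(b, a). a \<in> mirror.nbrs b}"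
    proof (cases "E a \<le> E b")
      case True
      then show ?thesis using x touches_mem by (simp add: nbrs_def)
    next
      case False
      then have "(b, a) \<in> {(b, a). a \<in> mirror.nbrs b}" using x touches_mem by (simp add: mirror.nbrs_def)
      then have "prod.swap (b, a) \<in> prod.swap ` {(b, a). a \<in> mirror.nbrs b}" by (rule imageI)
      then show ?thesis using x by simp
    qed
  qed
  then have "card {(a, b). touches a b} \<le> card ({(a, b). b \<in> nbrs a} \<union> prod.swap ` {(b, a). a \<in> mirror.nbrs b})"
    using f1 f2 by (intro card_mono) auto
  also have "\<dots> \<le> card {(a, b). b \<in> nbrs a} + card {(b, a). a \<in> mirror.nbrs b}"
    using card_Un_le[of "{(a, b). b \<in> nbrs a}" "prod.swap ` {(b, a). a \<in> mirror.nbrs b}"]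
      card_image_le[OF f2, of prod.swap] by linarith
  also have "\<dots> \<le> 340 * M ^ 16 + 340 * M ^ 16"
    using card_long_tangencies mirror.card_long_tangencies M by (intro add_mono) auto
  finally show ?thesis by simp
qed

end

section \<open>From plane curves to functions\<close>

lemma left_endpoint_graph:
  assumes "a < b" "c = (\<lambda>x. (x, f x)) ` {a..b}"
  shows "left_endpoint c = (a, f a)"
  unfolding left_endpoint_def arg_min_on_def
proof (rule arg_minI[of "\<lambda>x. x \<in> c" "(a, f a)"])
  fix x assume x: "x \<in> c" "\<forall>y. y \<in> c \<longrightarrow> \<not> fst y < fst x"
  obtain t where t: "x = (t, f t)" "a \<le> t" using x(1) assms(2) by auto
  have "(a, f a) \<in> c" using assms by auto
  then have "\<not> fst (a, f a) < fst x" using x(2) by blast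
  then show "x = (a, f a)" using t by simp
qed (use assms in auto)

text \<open>The start time is moved slightly to the right, so that curves sharing their left endpoint
  are separated.\<close>
lemma card_tangent_pairs:
  fixes C :: "(real \<times> real) set set"
  assumes C: "C = C1 \<union> C2" "finite C" "\<And>c. c \<in> C \<Longrightarrow> x_monotone_curve c"
    and one: "\<And>c d. c \<in> C \<Longrightarrow> d \<in> C \<Longrightarrow> c \<noteq> d \<Longrightarrow> finite (c \<inter> d) \<and> card (c \<inter> d) \<le> 1"
    and three: "\<And>c d g. c \<in> C \<Longrightarrow> d \<in> C \<Longrightarrow> g \<in> C \<Longrightarrow> c \<noteq> d \<Longrightarrow> c \<noteq> g \<Longrightarrow> d \<noteq> g \<Longrightarrow> c \<inter> d \<inter> g = {}"
    and x0: "\<And>c. c \<in> C \<Longrightarrow> fst (left_endpoint c) = x0"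
    and low: "\<And>c1 c2. c1 \<in> C1 \<Longrightarrow> c2 \<in> C2 \<Longrightarrow> snd (left_endpoint c1) < snd (left_endpoint c2)"
    and M: "M \<ge> 1" "card C \<le> M ^ 12"
  shows "card {(c1, c2). c1 \<in> C1 \<and> c2 \<in> C2 \<and> tangent c1 c2} \<le> 680 * M ^ 16"
proof -
  have "\<forall>c\<in>C. \<exists>e f. x0 < e \<and> continuous_on {x0..e} f \<and> c = (\<lambda>x. (x, f x)) ` {x0..e} \<and> left_endpoint c = (x0, f x0)"
  proof
    fix c assume c: "c \<in> C"
    then obtain a b f where f: "a < b" "continuous_on {a..b} f" "c = (\<lambda>x. (x, f x)) ` {a..b}"
      using C(3) unfolding x_monotone_curve_def by blast
    have "left_endpoint c = (a, f a)" using left_endpoint_graph f by blast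
    moreover from this have "a = x0" using x0[OF c] by simp
    ultimately show "\<exists>e f. x0 < e \<and> continuous_on {x0..e} f \<and> c = (\<lambda>x. (x, f x)) ` {x0..e} \<and> left_endpoint c = (x0, f x0)"
      using f by blast
  qed
  from bchoice[OF this] obtain E where "\<forall>c\<in>C. \<exists>f. x0 < E c \<and> continuous_on {x0..E c} f \<and>
      c = (\<lambda>x. (x, f x)) ` {x0..E c} \<and> left_endpoint c = (x0, f x0)" by blast
  from bchoice[OF this] obtain F where "\<forall>c\<in>C. x0 < E c \<and> continuous_on {x0..E c} (F c) \<and>
      c = (\<lambda>x. (x, F c x)) ` {x0..E c} \<and> left_endpoint c = (x0, F c x0)" by blast
  then have EF: "\<And>c. c \<in> C \<Longrightarrow> x0 < E c" "\<And>c. c \<in> C \<Longrightarrow> continuous_on {x0..E c} (F c)"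
    "\<And>c. c \<in> C \<Longrightarrow> c = (\<lambda>x. (x, F c x)) ` {x0..E c}" "\<And>c. c \<in> C \<Longrightarrow> left_endpoint c = (x0, F c x0)"
    by blast+
  have mem: "(x, y) \<in> c \<longleftrightarrow> x0 \<le> x \<and> x \<le> E c \<and> y = F c x" if "c \<in> C" for c x y
  proof -
    have "(x, y) \<in> (\<lambda>x. (x, F c x)) ` {x0..E c} \<longleftrightarrow> x0 \<le> x \<and> x \<le> E c \<and> y = F c x" by auto
    then show ?thesis using EF(3)[OF that] by simp
  qed
  define Z where "Z = {x. \<exists>c\<in>C. \<exists>d\<in>C. c \<noteq> d \<and> x0 < x \<and> x \<le> E c \<and> x \<le> E d \<and> F c x = F d x}"
  have "Z \<subseteq> (\<Union>c\<in>C. \<Union>d\<in>C - {c}. fst ` (c \<inter> d))"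
  proof
    fix x assume "x \<in> Z"
    then obtain c d where cd: "c \<in> C" "d \<in> C" "c \<noteq> d" "x0 < x" "x \<le> E c" "x \<le> E d" "F c x = F d x"
      by (auto simp: Z_def)
    then have "(x, F c x) \<in> c \<inter> d" using mem by auto
    then have "x \<in> fst ` (c \<inter> d)" by force
    then show "x \<in> (\<Union>c\<in>C. \<Union>d\<in>C - {c}. fst ` (c \<inter> d))" using cd by blast
  qed
  moreover have "finite (\<Union>c\<in>C. \<Union>d\<in>C - {c}. fst ` (c \<inter> d))"
    using C(2) one by (intro finite_UN_I finite_imageI) auto
  ultimately have finZ: "finite Z" by (rule finite_subset)
  \<comment> \<open>The element \<open>x0 + 1\<close> makes \<open>Min D\<close> meaningful for an
    empty family; the ends of the curves are included so that all curves are alive at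
    \<open>s0\<close>.\<close>
  define D where "D = insert (x0 + 1) (Z \<union> E ` C)"
  have D: "finite D" "D \<noteq> {}" using finZ C(2) by (auto simp: D_def)
  have "x0 < x" if "x \<in> D" for x using that EF(1) by (auto simp: D_def Z_def)
  then have "x0 < Min D" using D by simp
  then obtain s0 where s0: "x0 < s0" "s0 < Min D" using dense by blast
  have sZ: "s0 < x" if "x \<in> D" for x using s0 Min_le[OF D(1) that] by simp
  have meet: "\<exists>z. s \<le> z \<and> z \<le> u \<and> F c z = F d z"
    if "c \<in> C" "d \<in> C" "x0 \<le> s" "s \<le> u" "u \<le> E c" "u \<le> E d" "F c s \<le> F d s" "F d u \<le> F c u" for c d s u
    using that by (intro graphs_meet continuous_on_subset[OF EF(2)]) auto
  have once: "s = u" if "c \<in> C" "d \<in> C" "c \<noteq> d" "x0 \<le> s" "s \<le> E c" "s \<le> E d"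
    "x0 \<le> u" "u \<le> E c" "u \<le> E d" "F c s = F d s" "F c u = F d u" for c d s u
  proof -
    have "(s, F c s) \<in> c \<inter> d" "(u, F c u) \<in> c \<inter> d" using that mem by auto
    then have "(s, F c s) = (u, F c u)"
      using one[OF that(1-3)] card_le_Suc0_iff_eq[of "c \<inter> d"] by (metis One_nat_def)
    then show ?thesis by simp
  qed
  have start: "F a x0 < F b x0" if "a \<in> C1" "b \<in> C2" for a b
    using low[OF that] EF(4)[of a] EF(4)[of b] that C(1) by simp
  have start': "F a s0 < F b s0" if ab: "a \<in> C1" "b \<in> C2" for a b
  proof (rule ccontr)
    assume n: "\<not> F a s0 < F b s0"
    have m: "a \<in> C" "b \<in> C" using ab C(1) by auto
    then have "s0 < E a" "s0 < E b" using sZ by (auto simp: D_def)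
    then obtain z where z: "x0 \<le> z" "z \<le> s0" "F a z = F b z"
      using meet[of a b x0 s0] m start[OF ab] s0 n by force
    have "x0 < z" using z start[OF ab] by (cases "z = x0") auto
    then have "z \<in> D" using z m \<open>s0 < E a\<close> \<open>s0 < E b\<close> start[OF ab] unfolding D_def Z_def by force
    then show False using sZ z by fastforce
  qed
  have tangent: "\<exists>z. s0 < z \<and> z \<le> E a \<and> z \<le> E b \<and> F a z = F b z"
    "\<And>s. x0 \<le> s \<Longrightarrow> s \<le> E a \<Longrightarrow> s \<le> E b \<Longrightarrow> F a s \<le> F b s"
    if ab: "a \<in> C1" "b \<in> C2" "tangent a b" for a b
  proof -
    have m: "a \<in> C" "b \<in> C" "a \<noteq> b" using ab C(1) start by auto
    obtain p where p: "a \<inter> b = {p}" "\<not> crossing_point a b p" using ab by (auto simp: tangent_def)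
    obtain z y where zy: "p = (z, y)" by force
    have "(z, y) \<in> a" "(z, y) \<in> b" using p zy by auto
    then have z: "x0 \<le> z" "z \<le> E a" "z \<le> E b" "F a z = F b z" using m mem by auto
    have "x0 < z" using z start[OF ab(1,2)] by (cases "z = x0") auto
    then have "z \<in> D" using z m unfolding D_def Z_def by blast
    then show "\<exists>z. s0 < z \<and> z \<le> E a \<and> z \<le> E b \<and> F a z = F b z" using z sZ by blast
    show "F a s \<le> F b s" if s: "x0 \<le> s" "s \<le> E a" "s \<le> E b" for s
    proof (rule ccontr)
      assume n: "\<not> ?thesis"
      have uniq: "u = z" if "x0 \<le> u" "u \<le> E a" "u \<le> E b" "F a u = F b u" for u
        using once[of a b u z] that z m by blast
      obtain y' where y': "x0 \<le> y'" "y' \<le> s" "F a y' = F b y'"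
        using meet[of a b x0 s] m s n start[OF ab(1,2)] by force
      then have "y' = z" using uniq s by auto
      then have zs: "z < s" using y' n by (cases "z = s") auto
      have before: "F a u < F b u" if u: "x0 \<le> u" "u < z" for u
      proof (rule ccontr)
        assume n': "\<not> F a u < F b u"
        then obtain v where v: "x0 \<le> v" "v \<le> u" "F a v = F b v"
          using meet[of a b x0 u] m u z start[OF ab(1,2)] by force
        then show False using uniq[of v] u z by auto
      qed
      have after: "F b u < F a u" if u: "z < u" "u \<le> s" for u
      proof (rule ccontr)
        assume n': "\<not> F b u < F a u"
        then obtain v where v: "u \<le> v" "v \<le> s" "F a v = F b v"
          using meet[of a b u s] m u z s n by force
        then show False using uniq[of v] u z s by auto
      qed
      \<comment> \<open>The radius keeps both sides of \<open>z\<close> within the two curves: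
        \<open>z\<close> exceeds \<open>x0\<close>, and both curves still exist at \<open>s\<close>,
        which is after \<open>z\<close>. At a common point that ends one of the curves no such
        \<open>s\<close> exists.\<close>
      define e where "e = min (z - x0) (s - z)"
      have "0 < e" using zs \<open>x0 < z\<close> by (simp add: e_def)
      moreover have "below_over {z - e<..<z} a b"
        unfolding below_over_def using before mem m z by (auto simp: e_def)
      moreover have "below_over {z<..<z + e} b a"
        unfolding below_over_def using after mem m z s \<open>x0 < z\<close> by (auto simp: e_def)
      ultimately have "crossing_point a b p" using p(1) zy unfolding crossing_point_def by force
      then show False using p by simp
    qed
  qed
  interpret tangency_family C1 C2 F E s0 "\<lambda>a b. a \<in> C1 \<and> b \<in> C2 \<and> tangent a b"
  proof
    show "finite C1" "finite C2" using C by auto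
    show "C1 \<inter> C2 = {}" using low by blast
    show "s0 \<le> E c" if "c \<in> C1 \<union> C2" for c using sZ[of "E c"] that C(1) by (auto simp: D_def)
    show "continuous_on {s0..E c} (F c)" if "c \<in> C1 \<union> C2" for c
      using that C(1) s0 by (intro continuous_on_subset[OF EF(2)]) auto
    show "s = u" if "c \<in> C1 \<union> C2" "d \<in> C1 \<union> C2" "c \<noteq> d" "s0 \<le> s" "s \<le> E c" "s \<le> E d"
        "s0 \<le> u" "u \<le> E c" "u \<le> E d" "F c s = F d s" "F c u = F d u" for c d s u
      using once[of c d s u] that C(1) s0 by auto
    show False if "c \<in> C1 \<union> C2" "d \<in> C1 \<union> C2" "g \<in> C1 \<union> C2" "c \<noteq> d" "c \<noteq> g" "d \<noteq> g" "s0 \<le> s"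
        "s \<le> E c" "s \<le> E d" "s \<le> E g" "F c s = F d s" "F c s = F g s" for c d g s
    proof -
      have "(s, F c s) \<in> c \<inter> d \<inter> g" using that mem C(1) s0 by auto
      then show False using three[of c d g] that C(1) by auto
    qed
    show "c = d" if "c \<in> C1 \<union> C2" "d \<in> C1 \<union> C2" "F c s0 = F d s0" for c d
    proof (rule ccontr)
      assume "c \<noteq> d"
      moreover have "s0 < E c" "s0 < E d" using that sZ C(1) by (auto simp: D_def)
      ultimately have "s0 \<in> Z"
        using that C(1) s0(1) unfolding Z_def by (intro CollectI bexI[of _ c] bexI[of _ d]) auto
      then show False using sZ[of s0] by (simp add: D_def)
    qed
    show "F a s0 < F b s0" if "a \<in> C1" "b \<in> C2" for a b using start' that by blast
    show "F a s \<le> F b s" if "a \<in> C1 \<and> b \<in> C2 \<and> tangent a b" "s0 \<le> s" "s \<le> E a" "s \<le> E b" for a b s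
      using tangent(2)[of a b s] that s0 by auto
    show "\<exists>s. s0 \<le> s \<and> s \<le> E a \<and> s \<le> E b \<and> F a s = F b s" if "a \<in> C1 \<and> b \<in> C2 \<and> tangent a b" for a b
      using tangent(1)[of a b] that less_imp_le by blast
  qed auto
  have "card C1 \<le> M ^ 12" "card C2 \<le> M ^ 12"
    using M(2) card_mono[OF C(2), of C1] card_mono[OF C(2), of C2] C(1) by auto
  then show ?thesis using card_tangencies[OF M(1)] by simp
qed

theorem theorem25:
  "\<exists>d::real. \<forall>(n::nat) (C :: (real \<times> real) set set) C1 C2.
     C = C1 \<union> C2 \<longrightarrow> finite C \<longrightarrow> card C = n \<longrightarrow>
     (\<forall>c\<in>C. x_monotone_curve c) \<longrightarrow>
     (\<forall>c\<in>C. \<forall>c'\<in>C. c \<noteq> c' \<longrightarrow> finite (c \<inter> c') \<and> card (c \<inter> c') \<le> 1) \<longrightarrow>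
     (\<forall>c\<in>C. \<forall>c'\<in>C. \<forall>c''\<in>C. c \<noteq> c' \<longrightarrow> c \<noteq> c'' \<longrightarrow> c' \<noteq> c'' \<longrightarrow> c \<inter> c' \<inter> c'' = {}) \<longrightarrow>
     (\<exists>x0. \<forall>c\<in>C. fst (left_endpoint c) = x0) \<longrightarrow>
     (\<forall>c1\<in>C1. \<forall>c2\<in>C2. snd (left_endpoint c1) < snd (left_endpoint c2)) \<longrightarrow>
     real (card {{c1, c2} | c1 c2. c1 \<in> C1 \<and> c2 \<in> C2 \<and> tangent c1 c2}) \<le> d * real n powr (4/3)"
proof (rule exI[of _ "680 * 2 ^ 16"], intro allI impI)
  fix n :: nat and C C1 C2 :: "(real \<times> real) set set"
  assume C: "C = C1 \<union> C2" "finite C" "card C = n" "\<forall>c\<in>C. x_monotone_curve c"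
    and one: "\<forall>c\<in>C. \<forall>c'\<in>C. c \<noteq> c' \<longrightarrow> finite (c \<inter> c') \<and> card (c \<inter> c') \<le> 1"
    and three: "\<forall>c\<in>C. \<forall>c'\<in>C. \<forall>c''\<in>C. c \<noteq> c' \<longrightarrow> c \<noteq> c'' \<longrightarrow> c' \<noteq> c'' \<longrightarrow> c \<inter> c' \<inter> c'' = {}"
    and x0: "\<exists>x0. \<forall>c\<in>C. fst (left_endpoint c) = x0"
    and low: "\<forall>c1\<in>C1. \<forall>c2\<in>C2. snd (left_endpoint c1) < snd (left_endpoint c2)"
  let ?T = "{(c1, c2). c1 \<in> C1 \<and> c2 \<in> C2 \<and> tangent c1 c2}"
  show "real (card {{c1, c2} | c1 c2. c1 \<in> C1 \<and> c2 \<in> C2 \<and> tangent c1 c2}) \<le> 680 * 2 ^ 16 * real n powr (4/3)"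
  proof (cases "n = 0")
    case True
    then have "C1 = {}" using C by auto
    then show ?thesis using True by simp
  next
    case False
    \<comment> \<open>12 is the common denominator of the exponents 1/3 and 1/4 of the sampling and
      steepness scales. As \<open>r\<close> is at least 1, rounding it up at most doubles it, which
      costs the factor \<open>2 ^ 16\<close>.\<close>
    define r where "r = real n powr (1 / 12)"
    define M where "M = nat \<lceil>r\<rceil>"
    have r1: "1 \<le> r" using False by (simp add: r_def ge_one_powr_ge_zero)
    have M: "r \<le> real M" "real M \<le> 2 * r" "1 \<le> M" using r1 unfolding M_def by linarith+
    have rp: "r ^ k = real n powr (real k * (1 / 12))" for k
      unfolding r_def by (rule powr_power) (use False in simp)
    have "real n = r ^ 12" unfolding rp using False by simp
    also have "\<dots> \<le> real M ^ 12" using M r1 by (intro power_mono) auto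
    finally have "n \<le> M ^ 12" by (simp only: of_nat_le_iff flip: of_nat_power)
    have finT: "finite ?T"
      by (rule finite_subset[of _ "C1 \<times> C2"]) (use C in auto)
    have "{{c1, c2} | c1 c2. c1 \<in> C1 \<and> c2 \<in> C2 \<and> tangent c1 c2} = (\<lambda>(c1, c2). {c1, c2}) ` ?T"
      by (auto simp: image_iff)
    then have "card {{c1, c2} | c1 c2. c1 \<in> C1 \<and> c2 \<in> C2 \<and> tangent c1 c2} \<le> card ?T"
      using card_image_le[OF finT] by simp
    also obtain x where x: "\<And>c. c \<in> C \<Longrightarrow> fst (left_endpoint c) = x" using x0 by blast
    have "card ?T \<le> 680 * M ^ 16"
    proof (rule card_tangent_pairs[OF C(1,2)])
      show "card C \<le> M ^ 12" using \<open>n \<le> M ^ 12\<close> C(3) by simp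
      show "x_monotone_curve c" if "c \<in> C" for c using C(4) that by simp
      show "finite (c \<inter> d) \<and> card (c \<inter> d) \<le> 1" if "c \<in> C" "d \<in> C" "c \<noteq> d" for c d
        using one that by simp
      show "c \<inter> d \<inter> g = {}" if "c \<in> C" "d \<in> C" "g \<in> C" "c \<noteq> d" "c \<noteq> g" "d \<noteq> g" for c d g
        using three that by simp
      show "fst (left_endpoint c) = x" if "c \<in> C" for c using x[OF that] .
      show "snd (left_endpoint c1) < snd (left_endpoint c2)" if "c1 \<in> C1" "c2 \<in> C2" for c1 c2
        using low that by simp
      show "1 \<le> M" by (fact M)
    qed
    finally have "real (card {{c1, c2} | c1 c2. c1 \<in> C1 \<and> c2 \<in> C2 \<and> tangent c1 c2}) \<le> real (680 * M ^ 16)"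
      by (simp only: of_nat_le_iff)
    also have "\<dots> = 680 * real M ^ 16" by simp
    also have "\<dots> \<le> 680 * (2 * r) ^ 16" using M by (intro mult_left_mono power_mono) auto
    also have "\<dots> = 680 * 2 ^ 16 * r ^ 16" by (simp add: power_mult_distrib)
    also have "r ^ 16 = real n powr (4/3)" unfolding rp by simp
    finally show ?thesis .
  qed
qed

end
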